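(* Let $\phi^t$ be a discrete or continuous-time flow on $X$, let $M\subset X$ be an isolated compact $\phi^t$-invariant set which is not a repeller, and let $\psi:X\to\overline X$ be a diffeomorphism between the Riemannian manifolds $(X,d)$ and $(\overline X,\overline d)$. If $\overline\phi^t=\psi\phi^t\psi^{-1}$, $\overline x=\psi(x)$ and $\overline M=\psi(M)$, then $$\lambda(\phi^t,x)=\lambda(\overline\phi^t,\overline x)$$ and $$\Lambda(\phi^t,M)=\Lambda(\overline\phi^t,\overline M).$$ In particular, $\Lambda(\phi^t,M)$ is independent of Riemannian metrics.
   Context: Here $d$ and $\overline d$ are the distances of the Riemannian manifolds, $X$ is compact, and $x\in\mathrm{st}(M)$ is metric regular. For a flow $\phi^t$ ($t\in\mathbb R$ or $t\in\mathbb Z$) on a compact metric space $(X,d)$ and an isolated compact $\phi^t$-invariant set $M\subset X$, the stable set is $\mathrm{st}(M)=\{x\in X:\omega(x)\subset M\}$, where $\omega(x)$ is the omega-limit set. The condition that $M$ is not a repeller is said to be equivalent to $\mathrm{st}(M)$ being non-empty. A point $x\in\mathrm{st}(M)$ is metric regular if the limit $$\lambda(\phi^t,x)=\lim_{t\to\infty}\frac1t\log d(\phi^t(x),M)$$ exists; it is called the metric exponent of $\phi^t$ starting at $x$. The metric spectrum of $\phi^t$ relative to $M$ is $\Lambda(\phi^t,M)=\{\lambda(\phi^t,x):x\text{ is metric regular}\}$. For $\overline\phi^t$ the same notions are taken relative to $\overline M$ and $\overline d$. *)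

theory Defs
  imports "HOL-Analysis.Analysis"
begin

section \<open>Smooth manifolds\<close>

text \<open>For open \<open>S\<close>, a map is \<open>C\<^sup>k\<^sup>+\<^sup>1\<close> iff it is differentiable and all its directional
  derivatives \<open>x \<mapsto> Df(x) v\<close> are \<open>C\<^sup>k\<close>.\<close>

primrec Ck_on ::
  "nat \<Rightarrow> 'e::euclidean_space set \<Rightarrow> ('e \<Rightarrow> 'f::real_normed_vector) \<Rightarrow> bool" where
  "Ck_on 0 S f = continuous_on S f"
| "Ck_on (Suc k) S f =
     ((\<forall>x\<in>S. f differentiable (at x)) \<and>
      (\<forall>v. Ck_on k S (\<lambda>x. frechet_derivative f (at x) v)))"

definition smooth_on ::
  "'e::euclidean_space set \<Rightarrow> ('e \<Rightarrow> 'f::real_normed_vector) \<Rightarrow> bool" where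
  "smooth_on S f \<longleftrightarrow> (\<forall>k. Ck_on k S f)"

text \<open>A chart is a pair of its domain and its coordinate map; the values of the coordinate
  map outside the domain carry no meaning.\<close>

type_synonym ('a, 'e) chart = "'a set \<times> ('a \<Rightarrow> 'e)"

definition chart_on :: "'a topology \<Rightarrow> ('a, 'e::euclidean_space) chart \<Rightarrow> bool" where
  "chart_on X c \<longleftrightarrow> (case c of (U, \<phi>) \<Rightarrow>
     openin X U \<and> open (\<phi> ` U) \<and>
     homeomorphic_map (subtopology X U) (top_of_set (\<phi> ` U)) \<phi>)"

definition smooth_manifold ::
  "'a topology \<Rightarrow> ('a, 'e::euclidean_space) chart set \<Rightarrow> bool" where
  "smooth_manifold X A \<longleftrightarrow>
     Hausdorff_space X \<and> second_countable X \<and>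
     (\<forall>c\<in>A. chart_on X c) \<and> (\<Union>c\<in>A. fst c) = topspace X \<and>
     (\<forall>(U, \<phi>)\<in>A. \<forall>(V, \<theta>)\<in>A. smooth_on (\<phi> ` (U \<inter> V)) (\<theta> \<circ> inv_into U \<phi>))"

definition smooth_map ::
  "'a topology \<Rightarrow> ('a, 'e::euclidean_space) chart set \<Rightarrow>
   'b topology \<Rightarrow> ('b, 'f::euclidean_space) chart set \<Rightarrow> ('a \<Rightarrow> 'b) \<Rightarrow> bool" where
  "smooth_map X A Y B f \<longleftrightarrow>
     continuous_map X Y f \<and>
     (\<forall>(U, \<phi>)\<in>A. \<forall>(V, \<theta>)\<in>B.
        smooth_on (\<phi> ` {p\<in>U. f p \<in> V}) (\<theta> \<circ> f \<circ> inv_into U \<phi>))"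

definition diffeomorphism ::
  "'a topology \<Rightarrow> ('a, 'e::euclidean_space) chart set \<Rightarrow>
   'b topology \<Rightarrow> ('b, 'f::euclidean_space) chart set \<Rightarrow> ('a \<Rightarrow> 'b) \<Rightarrow> bool" where
  "diffeomorphism X A Y B f \<longleftrightarrow>
     bij_betw f (topspace X) (topspace Y) \<and>
     smooth_map X A Y B f \<and> smooth_map Y B X A (inv_into (topspace X) f)"


section \<open>Riemannian metrics and the Riemannian distance\<close>

text \<open>A Riemannian metric is given by its coordinate expressions: \<open>g (U, \<phi>) z\<close> is the inner
  product, read in the chart \<open>(U, \<phi>)\<close>, on the tangent space at the point with coordinates
  \<open>z \<in> \<phi> ` U\<close>. The last clause is the transformation law under a change of charts.\<close>

type_synonym ('a, 'e) metric_field = "('a, 'e) chart \<Rightarrow> 'e \<Rightarrow> 'e \<Rightarrow> 'e \<Rightarrow> real"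

definition riemannian_metric ::
  "('a, 'e::euclidean_space) chart set \<Rightarrow> ('a, 'e) metric_field \<Rightarrow> bool" where
  "riemannian_metric A g \<longleftrightarrow>
     (\<forall>(U, \<phi>)\<in>A. \<forall>z\<in>\<phi> ` U.
        bilinear (g (U, \<phi>) z) \<and>
        (\<forall>u v. g (U, \<phi>) z u v = g (U, \<phi>) z v u) \<and>
        (\<forall>u. u \<noteq> 0 \<longrightarrow> g (U, \<phi>) z u u > 0)) \<and>
     (\<forall>(U, \<phi>)\<in>A. \<forall>u v. smooth_on (\<phi> ` U) (\<lambda>z. g (U, \<phi>) z u v)) \<and>
     (\<forall>(U, \<phi>)\<in>A. \<forall>(V, \<theta>)\<in>A. \<forall>p\<in>U \<inter> V. \<forall>u v.
        (let D = frechet_derivative (\<theta> \<circ> inv_into U \<phi>) (at (\<phi> p))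
         in g (U, \<phi>) (\<phi> p) u v = g (V, \<theta>) (\<theta> p) (D u) (D v)))"

text \<open>Manifolds carrying a Riemannian distance are connected, so that the distance is finite.\<close>

definition riemannian_manifold ::
  "'a topology \<Rightarrow> ('a, 'e::euclidean_space) chart set \<Rightarrow> ('a, 'e) metric_field \<Rightarrow> bool" where
  "riemannian_manifold X A g \<longleftrightarrow>
     smooth_manifold X A \<and> connected_space X \<and> riemannian_metric A g"

definition C1_curve_on ::
  "'a topology \<Rightarrow> ('a, 'e::euclidean_space) chart set \<Rightarrow> real \<Rightarrow> real \<Rightarrow> (real \<Rightarrow> 'a) \<Rightarrow> bool" where
  "C1_curve_on X A a b \<gamma> \<longleftrightarrow>
     continuous_map (top_of_set {a..b}) X \<gamma> \<and>
     (\<forall>(U, \<phi>)\<in>A. \<exists>D. continuous_on {t\<in>{a..b}. \<gamma> t \<in> U} D \<and>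
        (\<forall>t\<in>{a..b}. \<gamma> t \<in> U \<longrightarrow>
           ((\<phi> \<circ> \<gamma>) has_vector_derivative D t) (at t within {a..b})))"

definition piecewise_C1_curve ::
  "'a topology \<Rightarrow> ('a, 'e::euclidean_space) chart set \<Rightarrow> (real \<Rightarrow> 'a) \<Rightarrow> bool" where
  "piecewise_C1_curve X A \<gamma> \<longleftrightarrow>
     (\<exists>(n::nat) s. s 0 = 0 \<and> s n = 1 \<and>
        (\<forall>i<n. s i < s (Suc i) \<and> C1_curve_on X A (s i) (s (Suc i)) \<gamma>))"

text \<open>By the transformation law the speed does not depend on which chart around
  \<open>\<gamma> t\<close> is chosen. At the finitely many break points of a piecewise \<open>C\<^sup>1\<close> curve its
  value is irrelevant for the length.\<close>

definition speed ::
  "('a, 'e::euclidean_space) chart set \<Rightarrow> ('a, 'e) metric_field \<Rightarrow> (real \<Rightarrow> 'a) \<Rightarrow> real \<Rightarrow> real" where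
  "speed A g \<gamma> t =
     (let c = (SOME c. c \<in> A \<and> \<gamma> t \<in> fst c);
          v = vector_derivative (snd c \<circ> \<gamma>) (at t within {0..1})
      in sqrt (g c (snd c (\<gamma> t)) v v))"

definition curve_length ::
  "('a, 'e::euclidean_space) chart set \<Rightarrow> ('a, 'e) metric_field \<Rightarrow> (real \<Rightarrow> 'a) \<Rightarrow> real" where
  "curve_length A g \<gamma> = integral {0..1} (speed A g \<gamma>)"

definition riemannian_dist ::
  "'a topology \<Rightarrow> ('a, 'e::euclidean_space) chart set \<Rightarrow> ('a, 'e) metric_field \<Rightarrow> 'a \<Rightarrow> 'a \<Rightarrow> real" where
  "riemannian_dist X A g p q =
     Inf {curve_length A g \<gamma> |\<gamma>. piecewise_C1_curve X A \<gamma> \<and> \<gamma> 0 = p \<and> \<gamma> 1 = q}"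


section \<open>Flows, stable sets and metric exponents\<close>

text \<open>The set \<open>T\<close> of times is \<open>\<real>\<close> or \<open>\<int>\<close>; the values \<open>\<Phi> t\<close> for \<open>t \<notin> T\<close> carry no
  meaning. For \<open>T = \<int>\<close> the topology on \<open>T\<close> is discrete, so \<open>\<Phi>\<close> amounts to the iterates
  of a homeomorphism.\<close>

definition flow :: "real set \<Rightarrow> 'a topology \<Rightarrow> (real \<Rightarrow> 'a \<Rightarrow> 'a) \<Rightarrow> bool" where
  "flow T X \<Phi> \<longleftrightarrow>
     (T = UNIV \<or> T = \<int>) \<and>
     continuous_map (prod_topology (top_of_set T) X) X (\<lambda>(t, x). \<Phi> t x) \<and>
     (\<forall>x\<in>topspace X. \<Phi> 0 x = x) \<and>
     (\<forall>s\<in>T. \<forall>t\<in>T. \<forall>x\<in>topspace X. \<Phi> (s + t) x = \<Phi> s (\<Phi> t x))"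

definition invariant_set :: "real set \<Rightarrow> (real \<Rightarrow> 'a \<Rightarrow> 'a) \<Rightarrow> 'a set \<Rightarrow> bool" where
  "invariant_set T \<Phi> M \<longleftrightarrow> (\<forall>t\<in>T. \<Phi> t ` M = M)"

text \<open>\<open>M\<close> contains every orbit that stays in some fixed neighbourhood of \<open>M\<close>.\<close>

definition isolated_set :: "real set \<Rightarrow> 'a topology \<Rightarrow> (real \<Rightarrow> 'a \<Rightarrow> 'a) \<Rightarrow> 'a set \<Rightarrow> bool" where
  "isolated_set T X \<Phi> M \<longleftrightarrow>
     (\<exists>N. openin X N \<and> M \<subseteq> N \<and>
        (\<forall>x\<in>topspace X. (\<forall>t\<in>T. \<Phi> t x \<in> N) \<longrightarrow> x \<in> M))"

definition omega_limit :: "real set \<Rightarrow> 'a topology \<Rightarrow> (real \<Rightarrow> 'a \<Rightarrow> 'a) \<Rightarrow> 'a \<Rightarrow> 'a set" where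
  "omega_limit T X \<Phi> x = (\<Inter>s\<in>T. X closure_of {\<Phi> t x |t. t \<in> T \<and> s \<le> t})"

text \<open>An invariant set that is not a repeller is one whose stable set is non-empty; in
  particular, on a compact space such a set is non-empty.\<close>

definition stable_set :: "real set \<Rightarrow> 'a topology \<Rightarrow> (real \<Rightarrow> 'a \<Rightarrow> 'a) \<Rightarrow> 'a set \<Rightarrow> 'a set" where
  "stable_set T X \<Phi> M = {x \<in> topspace X. omega_limit T X \<Phi> x \<subseteq> M}"

definition point_set_dist :: "('a \<Rightarrow> 'a \<Rightarrow> real) \<Rightarrow> 'a \<Rightarrow> 'a set \<Rightarrow> real" where
  "point_set_dist d x M = Inf (d x ` M)"

text \<open>The logarithm of a distance, with \<open>log 0 = -\<infinity>\<close> (whereas \<open>ln 0 = 0\<close> for reals).\<close>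

definition log_dist :: "real \<Rightarrow> ereal" where
  "log_dist r = (if r = 0 then -\<infinity> else ereal (ln r))"

text \<open>Limits of exponents are taken in the extended reals, so that \<open>-\<infinity>\<close> is a possible
  exponent. The exponents that exist as finite limits are the real members of the
  spectrum.\<close>

definition has_metric_exponent ::
  "real set \<Rightarrow> ('a \<Rightarrow> 'a \<Rightarrow> real) \<Rightarrow> (real \<Rightarrow> 'a \<Rightarrow> 'a) \<Rightarrow> 'a set \<Rightarrow> 'a \<Rightarrow> ereal \<Rightarrow> bool" where
  "has_metric_exponent T d \<Phi> M x l \<longleftrightarrow>
     ((\<lambda>t. ereal (1 / t) * log_dist (point_set_dist d (\<Phi> t x) M)) \<longlongrightarrow> l)
       (inf at_top (principal T))"

definition metric_regular ::
  "real set \<Rightarrow> 'a topology \<Rightarrow> ('a \<Rightarrow> 'a \<Rightarrow> real) \<Rightarrow> (real \<Rightarrow> 'a \<Rightarrow> 'a) \<Rightarrow> 'a set \<Rightarrow> 'a \<Rightarrow> bool" where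
  "metric_regular T X d \<Phi> M x \<longleftrightarrow>
     x \<in> stable_set T X \<Phi> M \<and> (\<exists>l. has_metric_exponent T d \<Phi> M x l)"

definition metric_exponent ::
  "real set \<Rightarrow> ('a \<Rightarrow> 'a \<Rightarrow> real) \<Rightarrow> (real \<Rightarrow> 'a \<Rightarrow> 'a) \<Rightarrow> 'a set \<Rightarrow> 'a \<Rightarrow> ereal" where
  "metric_exponent T d \<Phi> M x = (THE l. has_metric_exponent T d \<Phi> M x l)"

definition metric_spectrum ::
  "real set \<Rightarrow> 'a topology \<Rightarrow> ('a \<Rightarrow> 'a \<Rightarrow> real) \<Rightarrow> (real \<Rightarrow> 'a \<Rightarrow> 'a) \<Rightarrow> 'a set \<Rightarrow> ereal set" where
  "metric_spectrum T X d \<Phi> M =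
     {metric_exponent T d \<Phi> M x |x. metric_regular T X d \<Phi> M x}"

end

theory Submission
  imports Defs
begin

text \<open>A smooth map on a compact Riemannian manifold stretches tangent vectors by at most a fixed
  factor, because the ratio of the two quadratic forms is continuous on the unit sphere bundle.
  Hence it stretches lengths of curves, and so distances, by at most a fixed factor. Applied to
  \<open>\<psi>\<close> and its inverse this makes the two distances to \<open>M\<close> along an orbit comparable up to a
  constant \<open>K\<close>; their logarithms then differ by at most \<open>ln K\<close>, which disappears after division by
  \<open>t \<rightarrow> \<infinity>\<close>. Independence of the metric is the case \<open>\<psi> = id\<close>.\<close>

section \<open>Smooth maps in charts\<close>

text \<open>The stable set depends on the topology alone, so a homeomorphism transports it; only the
  exponents see the distances. A Riemannian distance is an infimum that is never computed: every
  curve from p to q is pushed forward to a competitor for the image points, which turns a bound on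
  speeds into a bound on distances. The speed is read in an arbitrarily chosen chart, so its
  continuity in time rests on the transformation law; its value at break points is uncontrolled, so
  pointwise estimates live on open pieces. Two degenerate values shape the estimates. Points joined
  by no curve have the distance \<open>Inf {}\<close>; the map and its inverse both carry curves, so
  such pairs correspond and get the same value on both sides. A distance 0 has logarithm -infinity;
  two-sided bounds make both distances vanish together, and a finite error added to -infinity
  changes nothing. The constant K comes from a finite cover by neighbourhoods with local bounds, and
  is kept at least 1 so that one can divide by it and \<open>ln K\<close> is non-negative.\<close>

lemma smooth_on_imp_differentiable:
  assumes "smooth_on S f" "x \<in> S"
  shows "f differentiable (at x)"
proof -
  have "Ck_on (Suc 0) S f"
    using assms(1) unfolding smooth_on_def by blast
  then show ?thesis using assms(2) by simp
qed

lemma smooth_on_imp_continuous_on: "smooth_on S f \<Longrightarrow> continuous_on S f"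
  unfolding smooth_on_def by (metis Ck_on.simps(1))

lemma smooth_on_imp_continuous_on_derivative:
  assumes "smooth_on S f"
  shows "continuous_on S (\<lambda>x. frechet_derivative f (at x) v)"
proof -
  have "Ck_on (Suc 0) S f"
    using assms unfolding smooth_on_def by blast
  then show ?thesis by simp
qed

text \<open>In finite dimension continuity at each fixed vector is enough: expanding
  \<open>v t\<close> in the basis leaves a finite sum of products of continuous functions.
  \<open>Ck_on\<close> supplies derivatives in exactly this vector-by-vector form.\<close>

lemma continuous_on_linear_family:
  fixes L :: "'s::topological_space \<Rightarrow> 'e::euclidean_space \<Rightarrow> 'f::real_normed_vector"
  assumes lin: "\<And>t. t \<in> K \<Longrightarrow> linear (L t)"
    and cont: "\<And>v. continuous_on K (\<lambda>t. L t v)"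
    and v: "continuous_on K v"
  shows "continuous_on K (\<lambda>t. L t (v t))"
proof -
  have "L t (v t) = (\<Sum>i\<in>Basis. (v t \<bullet> i) *\<^sub>R L t i)" if "t \<in> K" for t
  proof -
    have "L t (v t) = L t (\<Sum>i\<in>Basis. (v t \<bullet> i) *\<^sub>R i)"
      by (simp add: euclidean_representation)
    then show ?thesis
      using lin[OF that] by (simp add: linear_sum linear_cmul)
  qed
  moreover have "continuous_on K (\<lambda>t. \<Sum>i\<in>Basis. (v t \<bullet> i) *\<^sub>R L t i)"
    by (intro continuous_intros v cont)
  ultimately show ?thesis by simp
qed

text \<open>The linear case is used twice, inside for the first slot with the second one fixed,
  outside for the second slot.\<close>

lemma continuous_on_bilinear_family:
  fixes b :: "'s::topological_space \<Rightarrow> 'e::euclidean_space \<Rightarrow> 'e \<Rightarrow> 'f::real_normed_vector"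
  assumes bil: "\<And>t. t \<in> K \<Longrightarrow> bilinear (b t)"
    and cont: "\<And>u v. continuous_on K (\<lambda>t. b t u v)"
    and v: "continuous_on K v"
  shows "continuous_on K (\<lambda>t. b t (v t) (v t))"
  by (rule continuous_on_linear_family[where L = "\<lambda>t. b t (v t)"])
    (use bil v in \<open>auto simp: bilinear_def intro!: continuous_on_linear_family[where L = "\<lambda>t u. b t u _"] cont\<close>)

text \<open>Needed for functions of time along a curve, where each time has its own chart. The
  neighbourhoods are only relatively open, so that end points of the interval are covered.\<close>

lemma continuous_on_locally:
  fixes f :: "'s::t2_space \<Rightarrow> 't::topological_space"
  assumes "\<And>x. x \<in> S \<Longrightarrow> \<exists>N. openin (top_of_set S) N \<and> x \<in> N \<and> continuous_on N f"
  shows "continuous_on S f"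
  unfolding continuous_on_eq_continuous_within
proof
  fix x assume "x \<in> S"
  then obtain N where N: "openin (top_of_set S) N" "x \<in> N" "continuous_on N f"
    using assms by blast
  then obtain O' where O': "open O'" "N = S \<inter> O'"
    by (auto simp: openin_open)
  have "at x within N = at x within S"
    using N O' by (intro at_within_nhd[of _ O']) auto
  then show "continuous (at x within S) f"
    using N by (metis continuous_on_eq_continuous_within)
qed

section \<open>Charts of a smooth manifold\<close>

context
  fixes X :: "'a topology" and A :: "('a, 'e::euclidean_space) chart set"
  assumes X: "smooth_manifold X A"
begin

lemma chart_openin: "c \<in> A \<Longrightarrow> openin X (fst c)"
  and chart_homeomorphic: "c \<in> A \<Longrightarrow>
    homeomorphic_map (subtopology X (fst c)) (top_of_set (snd c ` fst c)) (snd c)"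
  and chart_open_image: "c \<in> A \<Longrightarrow> open (snd c ` fst c)"
  using X unfolding smooth_manifold_def chart_on_def by auto

lemma chart_around: "p \<in> topspace X \<Longrightarrow> \<exists>c\<in>A. p \<in> fst c"
  using X unfolding smooth_manifold_def by auto

lemma chart_subset: "c \<in> A \<Longrightarrow> fst c \<subseteq> topspace X"
  using chart_openin openin_subset by blast

lemma chart_inj_on: "c \<in> A \<Longrightarrow> inj_on (snd c) (fst c)"
  using chart_homeomorphic[of c] chart_subset[of c]
  by (simp add: homeomorphic_map_def inf.absorb2)

lemma chart_inv: "c \<in> A \<Longrightarrow> p \<in> fst c \<Longrightarrow> inv_into (fst c) (snd c) (snd c p) = p"
  by (simp add: chart_inj_on)

lemma chart_continuous_map:
  "c \<in> A \<Longrightarrow> continuous_map (subtopology X (fst c)) euclidean (snd c)"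
  using chart_homeomorphic[of c]
  by (meson continuous_map_into_fulltopology homeomorphic_imp_continuous_map)

lemma chart_open_map:
  assumes c: "c \<in> A" and W: "openin X W" "W \<subseteq> fst c"
  shows "open (snd c ` W)"
proof -
  have "openin (subtopology X (fst c)) W"
    using W unfolding openin_subtopology by blast
  then have "openin (top_of_set (snd c ` fst c)) (snd c ` W)"
    using homeomorphic_map_openness_eq[OF chart_homeomorphic[OF c]] by blast
  then show ?thesis
    using chart_open_image[OF c] by (metis openin_open_trans)
qed

end

section \<open>Curves and smooth maps in coordinates\<close>

abbreviation coord_rep ::
  "('a \<Rightarrow> 'b) \<Rightarrow> ('a, 'e::euclidean_space) chart \<Rightarrow> ('b, 'f::euclidean_space) chart \<Rightarrow> 'e \<Rightarrow> 'f"
  where "coord_rep f c c' \<equiv> snd c' \<circ> f \<circ> inv_into (fst c) (snd c)"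

abbreviation coord_deriv ::
  "('a \<Rightarrow> 'b) \<Rightarrow> ('a, 'e::euclidean_space) chart \<Rightarrow> ('b, 'f::euclidean_space) chart \<Rightarrow> 'e \<Rightarrow> 'e \<Rightarrow> 'f"
  where "coord_deriv f c c' z \<equiv> frechet_derivative (coord_rep f c c') (at z)"

lemma C1_curve_onD:
  assumes "C1_curve_on X A a b \<gamma>"
  shows C1_curve_on_continuous: "continuous_map (top_of_set {a..b}) X \<gamma>"
    and C1_curve_on_derivative: "c \<in> A \<Longrightarrow> \<exists>D. continuous_on {t\<in>{a..b}. \<gamma> t \<in> fst c} D \<and>
        (\<forall>t\<in>{a..b}. \<gamma> t \<in> fst c \<longrightarrow>
           ((snd c \<circ> \<gamma>) has_vector_derivative D t) (at t within {a..b}))"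
  using assms unfolding C1_curve_on_def by (auto split: prod.splits)

lemma C1_curve_on_in_topspace:
  "C1_curve_on X A a b \<gamma> \<Longrightarrow> t \<in> {a..b} \<Longrightarrow> \<gamma> t \<in> topspace X"
  using C1_curve_on_continuous[of X A a b \<gamma>] unfolding continuous_map_def by auto

lemma C1_curve_on_openin:
  assumes "C1_curve_on X A a b \<gamma>" "openin X W"
  shows "openin (top_of_set {a..b}) {t\<in>{a..b}. \<gamma> t \<in> W}"
  using openin_continuous_map_preimage[OF C1_curve_on_continuous[OF assms(1)] assms(2)] by simp

lemma C1_curve_on_continuous_coord:
  assumes X: "smooth_manifold X A" and \<gamma>: "C1_curve_on X A a b \<gamma>" and c: "c \<in> A"
  shows "continuous_on {t\<in>{a..b}. \<gamma> t \<in> fst c} (snd c \<circ> \<gamma>)"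
proof -
  obtain D where D: "\<forall>t\<in>{a..b}. \<gamma> t \<in> fst c \<longrightarrow>
      ((snd c \<circ> \<gamma>) has_vector_derivative D t) (at t within {a..b})"
    using C1_curve_on_derivative[OF \<gamma> c] by blast
  show ?thesis
    unfolding continuous_on_eq_continuous_within
  proof
    fix t assume "t \<in> {t\<in>{a..b}. \<gamma> t \<in> fst c}"
    then have "continuous (at t within {a..b}) (snd c \<circ> \<gamma>)"
      using D has_vector_derivative_continuous by blast
    then show "continuous (at t within {t\<in>{a..b}. \<gamma> t \<in> fst c}) (snd c \<circ> \<gamma>)"
      by (rule continuous_within_subset) auto
  qed
qed

locale manifold_map =
  fixes X :: "'a topology" and A :: "('a, 'e::euclidean_space) chart set"
    and Y :: "'b topology" and B :: "('b, 'f::euclidean_space) chart set" and f :: "'a \<Rightarrow> 'b"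
  assumes X: "smooth_manifold X A" and Y: "smooth_manifold Y B"
    and smooth: "smooth_map X A Y B f"
begin

lemma continuous_map_f: "continuous_map X Y f"
  using smooth unfolding smooth_map_def by blast

lemma smooth_on_coord_rep:
  "c \<in> A \<Longrightarrow> c' \<in> B \<Longrightarrow> smooth_on (snd c ` {p \<in> fst c. f p \<in> fst c'}) (coord_rep f c c')"
  using smooth unfolding smooth_map_def by (auto split: prod.splits)

lemma differentiable_coord_rep:
  "c \<in> A \<Longrightarrow> c' \<in> B \<Longrightarrow> p \<in> fst c \<Longrightarrow> f p \<in> fst c' \<Longrightarrow>
    coord_rep f c c' differentiable (at (snd c p))"
  by (rule smooth_on_imp_differentiable[OF smooth_on_coord_rep]) auto

lemma linear_coord_deriv:
  "c \<in> A \<Longrightarrow> c' \<in> B \<Longrightarrow> p \<in> fst c \<Longrightarrow> f p \<in> fst c' \<Longrightarrow> linear (coord_deriv f c c' (snd c p))"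
  by (intro linear_frechet_derivative differentiable_coord_rep)

lemma openin_preimage: "openin Y V \<Longrightarrow> openin X {p \<in> topspace X. f p \<in> V}"
  using openin_continuous_map_preimage[OF continuous_map_f] .

lemma openin_coord_domain:
  assumes "c \<in> A" "c' \<in> B"
  shows "openin X {p \<in> fst c. f p \<in> fst c'}"
proof -
  have "{p \<in> fst c. f p \<in> fst c'} = fst c \<inter> {p \<in> topspace X. f p \<in> fst c'}"
    using chart_subset[OF X assms(1)] by auto
  then show ?thesis
    using chart_openin[OF X assms(1)] openin_preimage[OF chart_openin[OF Y assms(2)]] by auto
qed

text \<open>This is the chain rule in coordinates. The composite of \<open>coord_rep f c c'\<close>
  with the coordinate curve agrees with the curve \<open>snd c' \<circ> (f \<circ> \<gamma>)\<close>
  only while \<open>\<gamma>\<close> stays in \<open>fst c\<close>; these times form a relatively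
  open set, which suffices for derivatives. The case \<open>f = id\<close> is the change of charts
  for velocities.\<close>

lemma has_vector_derivative_coord:
  assumes \<gamma>: "C1_curve_on X A a b \<gamma>" and c: "c \<in> A" and c': "c' \<in> B"
    and t: "t \<in> {a..b}" "\<gamma> t \<in> fst c" "f (\<gamma> t) \<in> fst c'"
    and v: "((snd c \<circ> \<gamma>) has_vector_derivative v) (at t within {a..b})"
  shows "((snd c' \<circ> (f \<circ> \<gamma>)) has_vector_derivative coord_deriv f c c' (snd c (\<gamma> t)) v)
    (at t within {a..b})"
proof -
  let ?F = "coord_rep f c c'" and ?D = "coord_deriv f c c' (snd c (\<gamma> t))"
  have diff: "(?F has_derivative ?D) (at ((snd c \<circ> \<gamma>) t))"
    using differentiable_coord_rep[OF c c' t(2,3)] by (simp add: frechet_derivative_works)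
  have "((\<lambda>s. ?F ((snd c \<circ> \<gamma>) s)) has_derivative (\<lambda>s. ?D (s *\<^sub>R v))) (at t within {a..b})"
    using has_derivative_compose[OF v[unfolded has_vector_derivative_def] diff] .
  moreover have "?D (s *\<^sub>R v) = s *\<^sub>R ?D v" for s
    using linear_coord_deriv[OF c c' t(2,3)] by (simp add: linear_cmul)
  ultimately have der: "((\<lambda>s. ?F ((snd c \<circ> \<gamma>) s)) has_derivative (\<lambda>s. s *\<^sub>R ?D v)) (at t within {a..b})"
    by simp
  have eq: "?F ((snd c \<circ> \<gamma>) s) = (snd c' \<circ> (f \<circ> \<gamma>)) s" if "\<gamma> s \<in> fst c" for s
    using chart_inv[OF X c that] by simp
  obtain O' where O': "open O'" "{s\<in>{a..b}. \<gamma> s \<in> fst c} = {a..b} \<inter> O'"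
    using C1_curve_on_openin[OF \<gamma> chart_openin[OF X c]] by (auto simp: openin_open)
  have "\<forall>\<^sub>F s in at t within {a..b}. ?F ((snd c \<circ> \<gamma>) s) = (snd c' \<circ> (f \<circ> \<gamma>)) s"
    unfolding eventually_at_topological
    by (rule exI[of _ O']) (use O' t eq in blast)
  then show ?thesis
    unfolding has_vector_derivative_def
    using der eq[OF t(2)] t(1) by (intro has_derivative_transform_eventually[OF der]) auto
qed

lemma continuous_on_coord_deriv:
  assumes c: "c \<in> A" "c' \<in> B"
    and z: "continuous_on K z" "z ` K \<subseteq> snd c ` {p \<in> fst c. f p \<in> fst c'}"
    and v: "continuous_on K v"
  shows "continuous_on K (\<lambda>t. coord_deriv f c c' (z t) (v t))"
proof (rule continuous_on_linear_family[where L = "\<lambda>t. coord_deriv f c c' (z t)", OF _ _ v])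
  fix t assume "t \<in> K"
  then obtain p where "p \<in> fst c" "f p \<in> fst c'" "z t = snd c p"
    using z(2) by auto
  then show "linear (coord_deriv f c c' (z t))"
    using linear_coord_deriv[OF c] by simp
next
  show "continuous_on K (\<lambda>t. coord_deriv f c c' (z t) u)" for u
    by (rule continuous_on_compose2[OF
          smooth_on_imp_continuous_on_derivative[OF smooth_on_coord_rep[OF c], of u] z])
qed

text \<open>A single continuous velocity is required on all times spent in a target chart, whereas
  the chain rule gives one formula per source chart. Since \<open>a < b\<close>, derivatives within
  the interval are unique, so \<open>vector_derivative\<close> agrees with each of these formulas
  and glues them together.\<close>

lemma C1_curve_on_image:
  assumes \<gamma>: "C1_curve_on X A a b \<gamma>" and ab: "a < b"
  shows "C1_curve_on Y B a b (f \<circ> \<gamma>)"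
  unfolding C1_curve_on_def
proof (intro conjI ballI)
  show "continuous_map (top_of_set {a..b}) Y (f \<circ> \<gamma>)"
    using C1_curve_on_continuous[OF \<gamma>] continuous_map_f continuous_map_compose by blast
next
  fix c' assume c': "c' \<in> B"
  let ?S = "{t\<in>{a..b}. (f \<circ> \<gamma>) t \<in> fst c'}"
  let ?D = "\<lambda>t. vector_derivative (snd c' \<circ> (f \<circ> \<gamma>)) (at t within {a..b})"
  have der: "((snd c' \<circ> (f \<circ> \<gamma>)) has_vector_derivative coord_deriv f c c' (snd c (\<gamma> t)) (D t))
      (at t within {a..b})"
    "?D t = coord_deriv f c c' (snd c (\<gamma> t)) (D t)"
    if "c \<in> A" "t \<in> ?S" "\<gamma> t \<in> fst c"
      "\<forall>t\<in>{a..b}. \<gamma> t \<in> fst c \<longrightarrow>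
        ((snd c \<circ> \<gamma>) has_vector_derivative D t) (at t within {a..b})" for c t D
  proof -
    show *: "((snd c' \<circ> (f \<circ> \<gamma>)) has_vector_derivative coord_deriv f c c' (snd c (\<gamma> t)) (D t))
      (at t within {a..b})"
      by (rule has_vector_derivative_coord[OF \<gamma> that(1) c']) (use that in auto)
    show "?D t = coord_deriv f c c' (snd c (\<gamma> t)) (D t)"
      using vector_derivative_within_cbox[OF ab] * that(2) by auto
  qed
  have "continuous_on ?S ?D"
  proof (rule continuous_on_locally)
    fix t assume t: "t \<in> ?S"
    then obtain c where c: "c \<in> A" "\<gamma> t \<in> fst c"
      using C1_curve_on_in_topspace[OF \<gamma>] chart_around[OF X] by blast
    obtain D where D: "continuous_on {t\<in>{a..b}. \<gamma> t \<in> fst c} D"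
      "\<forall>t\<in>{a..b}. \<gamma> t \<in> fst c \<longrightarrow>
        ((snd c \<circ> \<gamma>) has_vector_derivative D t) (at t within {a..b})"
      using C1_curve_on_derivative[OF \<gamma> c(1)] by blast
    let ?N = "{t\<in>?S. \<gamma> t \<in> fst c}"
    obtain O' where O': "open O'" "{s\<in>{a..b}. \<gamma> s \<in> fst c} = {a..b} \<inter> O'"
      using C1_curve_on_openin[OF \<gamma> chart_openin[OF X c(1)]] by (auto simp: openin_open)
    then have "?N = ?S \<inter> O'" by blast
    then have "openin (top_of_set ?S) ?N"
      using O'(1) by (simp add: openin_open_Int)
    moreover have "continuous_on ?N (\<lambda>t. coord_deriv f c c' ((snd c \<circ> \<gamma>) t) (D t))"
    proof (rule continuous_on_coord_deriv[OF c(1) c'])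
      show "continuous_on ?N (snd c \<circ> \<gamma>)"
        by (rule continuous_on_subset[OF C1_curve_on_continuous_coord[OF X \<gamma> c(1)]]) auto
      show "continuous_on ?N D"
        by (rule continuous_on_subset[OF D(1)]) auto
    qed auto
    then have "continuous_on ?N ?D"
      by (rule continuous_on_eq) (use der(2)[OF c(1) _ _ D(2)] in auto)
    ultimately show "\<exists>N. openin (top_of_set ?S) N \<and> t \<in> N \<and> continuous_on N ?D"
      using t c by blast
  qed
  moreover have "((snd c' \<circ> (f \<circ> \<gamma>)) has_vector_derivative ?D t) (at t within {a..b})" if t: "t \<in> ?S" for t
  proof -
    obtain c where c: "c \<in> A" "\<gamma> t \<in> fst c"
      using t C1_curve_on_in_topspace[OF \<gamma>] chart_around[OF X] by blast
    obtain D where D: "\<forall>t\<in>{a..b}. \<gamma> t \<in> fst c \<longrightarrow>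
        ((snd c \<circ> \<gamma>) has_vector_derivative D t) (at t within {a..b})"
      using C1_curve_on_derivative[OF \<gamma> c(1)] by blast
    show ?thesis
      using der[OF c(1) t c(2) D] by simp
  qed
  ultimately show "case c' of (V, \<theta>) \<Rightarrow> \<exists>D. continuous_on {t\<in>{a..b}. (f \<circ> \<gamma>) t \<in> V} D \<and>
        (\<forall>t\<in>{a..b}. (f \<circ> \<gamma>) t \<in> V \<longrightarrow>
           ((\<theta> \<circ> (f \<circ> \<gamma>)) has_vector_derivative D t) (at t within {a..b}))"
    by (cases c') auto
qed

lemma piecewise_C1_curve_image:
  "piecewise_C1_curve X A \<gamma> \<Longrightarrow> piecewise_C1_curve Y B (f \<circ> \<gamma>)"
  unfolding piecewise_C1_curve_def using C1_curve_on_image by meson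

end

section \<open>Lengths of curves under smooth maps\<close>

text \<open>Smoothness of \<open>id\<close> is smoothness of the transition maps. This makes the
  lemmas on maps available for changing charts, and later for comparing two metrics on one
  manifold.\<close>

lemma identity_manifold_map:
  assumes X: "smooth_manifold X A"
  shows "manifold_map X A X A id"
proof
  show "smooth_map X A X A id"
    using X unfolding smooth_map_def smooth_manifold_def
    by (auto simp: Int_def split: prod.splits)
qed (rule X)+

section \<open>Riemannian metrics in coordinates\<close>

context
  fixes A :: "('a, 'e::euclidean_space) chart set" and g :: "('a, 'e) metric_field"
  assumes g: "riemannian_metric A g"
begin

lemma riemannian_metric_bilinear: "c \<in> A \<Longrightarrow> p \<in> fst c \<Longrightarrow> bilinear (g c (snd c p))"
  and riemannian_metric_pos: "c \<in> A \<Longrightarrow> p \<in> fst c \<Longrightarrow> u \<noteq> 0 \<Longrightarrow> g c (snd c p) u u > 0"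
  using g unfolding riemannian_metric_def by (cases c; fastforce)+

lemma riemannian_metric_continuous_on:
  assumes "c \<in> A"
  shows "continuous_on (snd c ` fst c) (\<lambda>z. g c z u v)"
proof -
  have "smooth_on (snd c ` fst c) (\<lambda>z. g c z u v)"
    using g assms unfolding riemannian_metric_def by (cases c) fastforce
  then show ?thesis by (rule smooth_on_imp_continuous_on)
qed

text \<open>Rewriting the transition map as the coordinate form of \<open>id\<close> makes its
  derivative the same term that the chain rule produces.\<close>

lemma riemannian_metric_transform:
  assumes "c \<in> A" "c' \<in> A" "p \<in> fst c" "p \<in> fst c'"
  shows "g c (snd c p) u v =
    g c' (snd c' p) (coord_deriv id c c' (snd c p) u) (coord_deriv id c c' (snd c p) v)"
proof -
  have "\<forall>c\<in>A. \<forall>c'\<in>A. \<forall>p\<in>fst c \<inter> fst c'. \<forall>u v. g c (snd c p) u v =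
    g c' (snd c' p) (coord_deriv id c c' (snd c p) u) (coord_deriv id c c' (snd c p) v)"
    using conjunct2[OF conjunct2[OF g[unfolded riemannian_metric_def]]]
    unfolding case_prod_beta Let_def prod.collapse comp_id .
  then show ?thesis
    using assms by blast
qed

lemma riemannian_metric_nonneg:
  assumes "c \<in> A" "p \<in> fst c"
  shows "g c (snd c p) u u \<ge> 0"
proof (cases "u = 0")
  case True
  then show ?thesis
    using riemannian_metric_bilinear[OF assms] by (simp add: bilinear_lzero)
next
  case False
  then show ?thesis using riemannian_metric_pos[OF assms] by (simp add: less_imp_le)
qed

lemma continuous_on_riemannian_metric:
  assumes c: "c \<in> A" and z: "continuous_on K z" "z ` K \<subseteq> snd c ` fst c" and v: "continuous_on K v"
  shows "continuous_on K (\<lambda>t. g c (z t) (v t) (v t))"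
proof (rule continuous_on_bilinear_family[where b = "\<lambda>t. g c (z t)", OF _ _ v])
  fix t assume "t \<in> K"
  then obtain p where "p \<in> fst c" "z t = snd c p"
    using z(2) by auto
  then show "bilinear (g c (z t))"
    using riemannian_metric_bilinear[OF c] by simp
next
  show "continuous_on K (\<lambda>t. g c (z t) u v)" for u v
    by (rule continuous_on_compose2[OF riemannian_metric_continuous_on[OF c, of u v] z])
qed

end

text \<open>Velocities in \<open>speed\<close> are taken within \<open>{0..1}\<close>. Taking them within a piece \<open>{a..b}\<close>
  instead changes nothing in the interior and gives a function that is continuous up to the
  end points.\<close>

definition speed_on ::
  "real \<Rightarrow> real \<Rightarrow> ('a, 'e::euclidean_space) chart set \<Rightarrow> ('a, 'e) metric_field \<Rightarrow>
    (real \<Rightarrow> 'a) \<Rightarrow> real \<Rightarrow> real" where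
  "speed_on a b A g \<gamma> t =
     (let c = (SOME c. c \<in> A \<and> \<gamma> t \<in> fst c);
          v = vector_derivative (snd c \<circ> \<gamma>) (at t within {a..b})
      in sqrt (g c (snd c (\<gamma> t)) v v))"

lemma speed_on_interior:
  assumes "t \<in> {a<..<b}" "0 \<le> a" "b \<le> 1"
  shows "speed_on a b A g \<gamma> t = speed A g \<gamma> t"
proof -
  have "at t within {a..b} = at t within {0..1}"
    using assms by (simp add: at_within_Icc_at)
  then show ?thesis
    by (simp add: speed_on_def speed_def)
qed

section \<open>Speed on one piece of a curve\<close>

context
  fixes X :: "'a topology" and A :: "('a, 'e::euclidean_space) chart set"
    and g :: "('a, 'e) metric_field" and a b \<gamma>
  assumes X: "smooth_manifold X A" and g: "riemannian_metric A g"
    and \<gamma>: "C1_curve_on X A a b \<gamma>" and ab: "a < b"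
begin

text \<open>The chart picked by \<open>SOME\<close> is harmless: the chain rule for
  \<open>id\<close> carries the velocity \<open>v\<close> into that chart, and the transformation
  law says that its length is unchanged.\<close>

lemma speed_on_coord:
  assumes t: "t \<in> {a..b}" and c: "c \<in> A" "\<gamma> t \<in> fst c"
    and v: "((snd c \<circ> \<gamma>) has_vector_derivative v) (at t within {a..b})"
  shows "speed_on a b A g \<gamma> t = sqrt (g c (snd c (\<gamma> t)) v v)"
proof -
  interpret id: manifold_map X A X A id
    by (rule identity_manifold_map[OF X])
  define c' where "c' = (SOME c. c \<in> A \<and> \<gamma> t \<in> fst c)"
  have c': "c' \<in> A" "\<gamma> t \<in> fst c'"
    using someI[of "\<lambda>c. c \<in> A \<and> \<gamma> t \<in> fst c" c] c unfolding c'_def by auto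
  let ?v = "coord_deriv id c c' (snd c (\<gamma> t)) v"
  have "((snd c' \<circ> (id \<circ> \<gamma>)) has_vector_derivative ?v) (at t within {a..b})"
    by (rule id.has_vector_derivative_coord[OF \<gamma> c(1) c'(1) t c(2) _ v]) (simp add: c')
  then have "vector_derivative (snd c' \<circ> \<gamma>) (at t within {a..b}) = ?v"
    using vector_derivative_within_cbox[OF ab] t by simp
  then have "speed_on a b A g \<gamma> t = sqrt (g c' (snd c' (\<gamma> t)) ?v ?v)"
    by (simp add: speed_on_def Let_def flip: c'_def)
  then show ?thesis
    using riemannian_metric_transform[OF g c(1) c'(1) c(2) c'(2)] by metis
qed

text \<open>The chosen chart may jump with time, but near each time the speed can be rewritten in
  one fixed chart, where the formula is visibly continuous.\<close>

lemma continuous_on_speed_on: "continuous_on {a..b} (speed_on a b A g \<gamma>)"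
proof (rule continuous_on_locally)
  fix t assume t: "t \<in> {a..b}"
  then obtain c where c: "c \<in> A" "\<gamma> t \<in> fst c"
    using C1_curve_on_in_topspace[OF \<gamma>] chart_around[OF X] by blast
  let ?N = "{t\<in>{a..b}. \<gamma> t \<in> fst c}"
  obtain D where D: "continuous_on ?N D"
    "\<forall>t\<in>{a..b}. \<gamma> t \<in> fst c \<longrightarrow>
      ((snd c \<circ> \<gamma>) has_vector_derivative D t) (at t within {a..b})"
    using C1_curve_on_derivative[OF \<gamma> c(1)] by blast
  have "continuous_on ?N (\<lambda>t. sqrt (g c ((snd c \<circ> \<gamma>) t) (D t) (D t)))"
    by (intro continuous_on_real_sqrt continuous_on_riemannian_metric[OF g c(1)]
        C1_curve_on_continuous_coord[OF X \<gamma> c(1)] D(1)) auto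
  then have "continuous_on ?N (speed_on a b A g \<gamma>)"
    by (rule continuous_on_eq) (use speed_on_coord[OF _ c(1)] D(2) in auto)
  then show "\<exists>N. openin (top_of_set {a..b}) N \<and> t \<in> N \<and> continuous_on N (speed_on a b A g \<gamma>)"
    using C1_curve_on_openin[OF \<gamma> chart_openin[OF X c(1)]] t c(2) by blast
qed

lemma speed_integrable_on:
  assumes "0 \<le> a" "b \<le> 1"
  shows "speed A g \<gamma> integrable_on {a..b}"
proof (rule integrable_spike_finite[of "{a, b}" _ _ "speed_on a b A g \<gamma>"])
  show "speed A g \<gamma> t = speed_on a b A g \<gamma> t" if "t \<in> {a..b} - {a, b}" for t
    using speed_on_interior[of t a b A g \<gamma>] that assms by auto
  show "speed_on a b A g \<gamma> integrable_on {a..b}"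
    by (rule integrable_continuous_real[OF continuous_on_speed_on])
qed simp

end

text \<open>The inequality is asked for only inside the pieces, since speeds at break points are
  arbitrary; integrals do not see the end points. Pieces are added by induction, carrying
  integrability along because additivity of the integral depends on it.\<close>

lemma piecewise_integral_le:
  fixes F G :: "real \<Rightarrow> real" and s :: "nat \<Rightarrow> real"
  assumes s: "\<And>i. i < n \<Longrightarrow> s i < s (Suc i)"
    and F: "\<And>i. i < n \<Longrightarrow> F integrable_on {s i..s (Suc i)}"
    and G: "\<And>i. i < n \<Longrightarrow> G integrable_on {s i..s (Suc i)}"
    and le: "\<And>i t. i < n \<Longrightarrow> t \<in> {s i<..<s (Suc i)} \<Longrightarrow> F t \<le> G t"
  shows "integral {s 0..s n} F \<le> integral {s 0..s n} G"
proof -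
  have "s 0 \<le> s k \<and> F integrable_on {s 0..s k} \<and> G integrable_on {s 0..s k} \<and>
      integral {s 0..s k} F \<le> integral {s 0..s k} G" if "k \<le> n" for k
    using that
  proof (induction k)
    case 0
    then show ?case using integrable_on_refl[of F "s 0"] integrable_on_refl[of G "s 0"] by simp
  next
    case (Suc k)
    then have IH: "s 0 \<le> s k" "F integrable_on {s 0..s k}" "G integrable_on {s 0..s k}"
      "integral {s 0..s k} F \<le> integral {s 0..s k} G" and k: "k < n"
      by auto
    have "integral {s k..s (Suc k)} F \<le> integral {s k..s (Suc k)} G"
      unfolding integral_open_interval_real
      using F[OF k] G[OF k] le[OF k]
      by (intro integral_le) (auto simp: integrable_on_Icc_iff_Ioo)
    moreover have int: "F integrable_on {s 0..s (Suc k)}" "G integrable_on {s 0..s (Suc k)}"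
      using Henstock_Kurzweil_Integration.integrable_combine[OF IH(1) less_imp_le[OF s[OF k]]]
        IH(2,3) F[OF k] G[OF k] by blast+
    ultimately show ?case
      using IH s[OF k]
        Henstock_Kurzweil_Integration.integral_combine[OF IH(1) less_imp_le[OF s[OF k]] int(1)]
        Henstock_Kurzweil_Integration.integral_combine[OF IH(1) less_imp_le[OF s[OF k]] int(2)]
      by linarith
  qed
  then show ?thesis by blast
qed

text \<open>The added bounds place each piece inside \<open>{0..1}\<close>, so that in its interior
  \<open>speed\<close> and \<open>speed_on\<close> take the same derivative.\<close>

lemma piecewise_C1_curve_pieces:
  assumes "piecewise_C1_curve X A \<gamma>"
  shows "\<exists>(n::nat) s. s 0 = 0 \<and> s n = 1 \<and> (\<forall>i<n. s i < s (Suc i) \<and>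
    0 \<le> s i \<and> s (Suc i) \<le> 1 \<and> C1_curve_on X A (s i) (s (Suc i)) \<gamma>)"
proof -
  obtain n :: nat and s where s: "s 0 = 0" "s n = 1"
    and pieces: "\<forall>i<n. s i < s (Suc i) \<and> C1_curve_on X A (s i) (s (Suc i)) \<gamma>"
    using assms unfolding piecewise_C1_curve_def by blast
  have mono: "s i \<le> s j" if "i \<le> j" "j \<le> n" for i j
    using that
  proof (induction j rule: dec_induct)
    case (step j)
    then show ?case using pieces by (meson Suc_leD Suc_le_lessD less_imp_le order_trans)
  qed simp
  have "0 \<le> s i \<and> s (Suc i) \<le> 1" if "i < n" for i
    using mono[of 0 i] mono[of "Suc i" n] s that by simp
  then show ?thesis
    using s pieces by blast
qed

text \<open>This bounds the set of lengths below, so that a real infimum over it is meaningful; it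
  is a comparison with the zero function.\<close>

lemma curve_length_nonneg:
  assumes X: "smooth_manifold X A" and g: "riemannian_metric A g"
    and \<gamma>: "piecewise_C1_curve X A \<gamma>"
  shows "curve_length A g \<gamma> \<ge> 0"
proof -
  obtain n :: nat and s where s: "s 0 = 0" "s n = 1"
    and pieces: "\<forall>i<n. s i < s (Suc i) \<and> 0 \<le> s i \<and> s (Suc i) \<le> 1 \<and>
      C1_curve_on X A (s i) (s (Suc i)) \<gamma>"
    using piecewise_C1_curve_pieces[OF \<gamma>] by blast
  have "integral {s 0..s n} (\<lambda>t. 0) \<le> integral {s 0..s n} (speed A g \<gamma>)"
  proof (rule piecewise_integral_le)
    fix i assume i: "i < n"
    have \<gamma>i: "C1_curve_on X A (s i) (s (Suc i)) \<gamma>"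
      using pieces i by blast
    show "speed A g \<gamma> integrable_on {s i..s (Suc i)}"
      using speed_integrable_on[OF X g \<gamma>i] pieces i by blast
    fix t assume "t \<in> {s i<..<s (Suc i)}"
    then obtain c where c: "c \<in> A" "\<gamma> t \<in> fst c"
      using C1_curve_on_in_topspace[OF \<gamma>i] chart_around[OF X]
      by (metis greaterThanLessThan_iff atLeastAtMost_iff less_imp_le)
    have "(SOME c. c \<in> A \<and> \<gamma> t \<in> fst c) \<in> A \<and> \<gamma> t \<in> fst (SOME c. c \<in> A \<and> \<gamma> t \<in> fst c)"
      using someI[of "\<lambda>c. c \<in> A \<and> \<gamma> t \<in> fst c" c] c by blast
    then show "0 \<le> speed A g \<gamma> t"
      unfolding speed_def Let_def
      by (intro real_sqrt_ge_zero riemannian_metric_nonneg[OF g]) auto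
  qed (use pieces in auto)
  then show ?thesis
    using s by (simp add: curve_length_def)
qed

section \<open>Dilation of a smooth map and lengths of image curves\<close>

locale riemannian_map = manifold_map X A Y B f
  for X :: "'a topology" and A :: "('a, 'e::euclidean_space) chart set"
    and Y :: "'b topology" and B :: "('b, 'f::euclidean_space) chart set" and f :: "'a \<Rightarrow> 'b" +
  fixes g :: "('a, 'e) metric_field" and h :: "('b, 'f) metric_field"
  assumes g: "riemannian_metric A g" and h: "riemannian_metric B h"
begin

text \<open>K bounds the ratio of quadratic forms, hence the square of the stretching of tangent
  vectors; speeds and lengths therefore pick up \<open>sqrt K\<close>.\<close>

definition dilation_le ::
  "('a, 'e) chart \<Rightarrow> ('b, 'f) chart \<Rightarrow> 'a \<Rightarrow> real \<Rightarrow> bool" where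
  "dilation_le c c' p K \<longleftrightarrow> (\<forall>v.
     h c' (snd c' (f p)) (coord_deriv f c c' (snd c p) v) (coord_deriv f c c' (snd c p) v)
      \<le> K * g c (snd c p) v v)"

lemma dilation_le_mono:
  assumes "dilation_le c c' p K" "K \<le> L" "c \<in> A" "p \<in> fst c"
  shows "dilation_le c c' p L"
  unfolding dilation_le_def
proof
  fix v
  have "K * g c (snd c p) v v \<le> L * g c (snd c p) v v"
    by (rule mult_right_mono[OF assms(2) riemannian_metric_nonneg[OF g assms(3,4)]])
  then show "h c' (snd c' (f p)) (coord_deriv f c c' (snd c p) v) (coord_deriv f c c' (snd c p) v)
      \<le> L * g c (snd c p) v v"
    by (rule order_trans[OF assms(1)[unfolded dilation_le_def, rule_format]])
qed

lemma speed_image_le: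
  assumes \<gamma>: "C1_curve_on X A a b \<gamma>" and ab: "0 \<le> a" "b \<le> 1" and t: "t \<in> {a<..<b}"
    and c: "c \<in> A" "\<gamma> t \<in> fst c" "c' \<in> B" "f (\<gamma> t) \<in> fst c'"
    and le: "dilation_le c c' (\<gamma> t) K"
  shows "speed B h (f \<circ> \<gamma>) t \<le> sqrt K * speed A g \<gamma> t"
proof -
  have "a < b" and t': "t \<in> {a..b}" using t by auto
  obtain v where v: "((snd c \<circ> \<gamma>) has_vector_derivative v) (at t within {a..b})"
    using C1_curve_on_derivative[OF \<gamma> c(1)] t' c(2) by blast
  let ?w = "coord_deriv f c c' (snd c (\<gamma> t)) v"
  have "speed_on a b B h (f \<circ> \<gamma>) t = sqrt (h c' (snd c' ((f \<circ> \<gamma>) t)) ?w ?w)"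
    by (rule speed_on_coord[OF Y h C1_curve_on_image[OF \<gamma> \<open>a < b\<close>] \<open>a < b\<close> t' c(3)])
      (use has_vector_derivative_coord[OF \<gamma> c(1,3) t' c(2,4) v] c(4) in auto)
  also have "\<dots> \<le> sqrt (K * g c (snd c (\<gamma> t)) v v)"
    using le by (simp add: dilation_le_def)
  also have "\<dots> = sqrt K * speed_on a b A g \<gamma> t"
    using speed_on_coord[OF X g \<gamma> \<open>a < b\<close> t' c(1,2) v] by (simp add: real_sqrt_mult)
  finally show ?thesis
    using speed_on_interior[OF t ab] by metis
qed

text \<open>One pair of charts has to serve all of W. Shrinking W to a point leaves only the
  existence of suitable charts there, and in this form bounds from different neighbourhoods can
  share a constant.\<close>

definition dilation_bounded :: "'a set \<Rightarrow> real \<Rightarrow> bool" where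
  "dilation_bounded W K \<longleftrightarrow>
    (\<exists>c\<in>A. \<exists>c'\<in>B. W \<subseteq> fst c \<and> f ` W \<subseteq> fst c' \<and> (\<forall>q\<in>W. dilation_le c c' q K))"

lemma dilation_bounded_mono:
  assumes "dilation_bounded W K" "V \<subseteq> W" "K \<le> L"
  shows "dilation_bounded V L"
proof -
  obtain c c' where c: "c \<in> A" "c' \<in> B" "W \<subseteq> fst c" "f ` W \<subseteq> fst c'"
    "\<forall>q\<in>W. dilation_le c c' q K"
    using assms(1) unfolding dilation_bounded_def by blast
  have "\<forall>q\<in>V. dilation_le c c' q L"
    using c assms(2,3) dilation_le_mono by blast
  moreover have "V \<subseteq> fst c" "f ` V \<subseteq> fst c'"
    using assms(2) c by blast+
  ultimately show ?thesis
    unfolding dilation_bounded_def using c(1,2) by blast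
qed

text \<open>In coordinates, the ratio of the two forms is continuous on a compact set of points and
  unit directions, hence bounded; homogeneity extends the bound to all vectors.\<close>

lemma dilation_locally_bounded:
  assumes p: "p \<in> topspace X"
  shows "\<exists>W K. openin X W \<and> p \<in> W \<and> 0 \<le> K \<and> dilation_bounded W K"
proof -
  obtain c where c: "c \<in> A" "p \<in> fst c"
    using chart_around[OF X p] by blast
  have "f p \<in> topspace Y"
    using continuous_map_f p by (auto simp: continuous_map_def)
  then obtain c' where c': "c' \<in> B" "f p \<in> fst c'"
    using chart_around[OF Y] by blast
  let ?P = "{q \<in> fst c. f q \<in> fst c'}"
  let ?D = "coord_deriv f c c'"
  have "open (snd c ` ?P)"
    by (rule chart_open_map[OF X c(1) openin_coord_domain[OF c(1) c'(1)]]) auto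
  moreover have "snd c p \<in> snd c ` ?P"
    using c c' by blast
  ultimately obtain r where r: "r > 0" "cball (snd c p) r \<subseteq> snd c ` ?P"
    using open_contains_cball by blast
  \<comment> \<open>The sphere is Euclidean in the coordinates and not the unit sphere of
    \<open>g\<close>: the set becomes a compact product, and its directions are non-zero, so the
    denominator \<open>G\<close> is positive.\<close>
  define N where "N = cball (snd c p) r \<times> sphere (0::'e) 1"
  have N: "z \<in> snd c ` ?P" "v \<noteq> 0" if "(z, v) \<in> N" for z v
    using that r(2) by (auto simp: N_def)
  have sub: "fst ` N \<subseteq> snd c ` ?P"
    using N by auto
  have "compact N"
    unfolding N_def by (intro compact_Times) auto
  define G where "G x = g c (fst x) (snd x) (snd x)" for x
  define H where "H x = h c' (coord_rep f c c' (fst x)) (?D (fst x) (snd x)) (?D (fst x) (snd x))" for x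
  have cont_fst: "continuous_on N fst" and cont_snd: "continuous_on N snd"
    by (intro continuous_intros)+
  have "continuous_on N G"
    unfolding G_def
    by (rule continuous_on_riemannian_metric[OF g c(1) cont_fst _ cont_snd]) (use sub in auto)
  moreover have "continuous_on N H"
    unfolding H_def
  proof (rule continuous_on_riemannian_metric[OF h c'(1)])
    show "continuous_on N (\<lambda>x. coord_rep f c c' (fst x))"
      by (rule continuous_on_compose2[OF
            smooth_on_imp_continuous_on[OF smooth_on_coord_rep[OF c(1) c'(1)]] cont_fst sub])
    show "(\<lambda>x. coord_rep f c c' (fst x)) ` N \<subseteq> snd c' ` fst c'"
      using sub chart_inv[OF X c(1)] by fastforce
    show "continuous_on N (\<lambda>x. ?D (fst x) (snd x))"
      by (rule continuous_on_coord_deriv[OF c(1) c'(1) cont_fst sub cont_snd])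
  qed
  moreover have Gpos: "G x > 0" if x: "x \<in> N" for x
  proof -
    obtain q where "q \<in> fst c" "fst x = snd c q" "snd x \<noteq> 0"
      using N[of "fst x" "snd x"] x by auto
    then show ?thesis
      using riemannian_metric_pos[OF g c(1)] by (simp add: G_def)
  qed
  ultimately have "continuous_on N (\<lambda>x. H x / G x)"
    by (intro continuous_on_divide) (auto simp: less_imp_neq[symmetric])
  then have "bounded ((\<lambda>x. H x / G x) ` N)"
    using \<open>compact N\<close> compact_continuous_image compact_imp_bounded by blast
  then obtain K where K: "K > 0" "\<And>x. x \<in> N \<Longrightarrow> \<bar>H x / G x\<bar> \<le> K"
    unfolding bounded_pos by auto
  \<comment> \<open>The open ball makes W open, while the closed ball around it gave the compactness
    behind K.\<close>
  define W where "W = {q \<in> fst c. snd c q \<in> ball (snd c p) r}"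
  have "openin (subtopology X (fst c)) {q \<in> topspace (subtopology X (fst c)). snd c q \<in> ball (snd c p) r}"
    by (rule openin_continuous_map_preimage[OF chart_continuous_map[OF X c(1)]]) simp
  then have "openin (subtopology X (fst c)) W"
    using chart_subset[OF X c(1)] by (simp add: W_def inf.absorb2)
  then have "openin X W"
    using chart_openin[OF X c(1)] openin_open_subtopology by blast
  moreover have "p \<in> W"
    using c r by (simp add: W_def)
  \<comment> \<open>The radius controls coordinates only; injectivity of the chart turns this into a
    statement about points.\<close>
  moreover have WP: "W \<subseteq> ?P"
  proof
    fix q assume q: "q \<in> W"
    then have "snd c q \<in> snd c ` ?P"
      using r(2) by (auto simp: W_def)
    then obtain q' where "q' \<in> ?P" "snd c q = snd c q'" by blast
    then show "q \<in> ?P"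
      using chart_inj_on[OF X c(1)] q by (auto simp: W_def dest: inj_onD)
  qed
  moreover have "dilation_le c c' q K" if q: "q \<in> W" for q
    unfolding dilation_le_def
  proof
    fix v
    have q': "q \<in> fst c" "f q \<in> fst c'" using WP q by auto
    have lin: "linear (?D (snd c q))"
      by (rule linear_coord_deriv[OF c(1) c'(1) q'])
    have bg: "bilinear (g c (snd c q))" and bh: "bilinear (h c' (snd c' (f q)))"
      by (rule riemannian_metric_bilinear[OF g c(1) q'(1)], rule riemannian_metric_bilinear[OF h c'(1) q'(2)])
    show "h c' (snd c' (f q)) (?D (snd c q) v) (?D (snd c q) v) \<le> K * g c (snd c q) v v"
    proof (cases "v = 0")
      case True
      then show ?thesis
        using lin bg bh by (simp add: linear_0 bilinear_lzero)
    next
      case False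
      \<comment> \<open>Both sides are quadratic in v, so scaling back from u multiplies each by the
        square of \<open>norm v\<close>.\<close>
      define u where "u = v /\<^sub>R norm v"
      have v: "v = norm v *\<^sub>R u" using False by (simp add: u_def)
      have N: "(snd c q, u) \<in> N"
        using q False by (simp add: N_def W_def u_def)
      have "H (snd c q, u) \<le> K * G (snd c q, u)"
        using K(2)[OF N] Gpos[OF N] by (simp add: field_simps abs_le_iff)
      then have "h c' (snd c' (f q)) (?D (snd c q) u) (?D (snd c q) u) \<le> K * g c (snd c q) u u"
        using chart_inv[OF X c(1) q'(1)] by (simp add: H_def G_def)
      then have "norm v * (norm v * h c' (snd c' (f q)) (?D (snd c q) u) (?D (snd c q) u))
          \<le> norm v * (norm v * (K * g c (snd c q) u u))"
        by (intro mult_left_mono) auto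
      moreover have "h c' (snd c' (f q)) (?D (snd c q) v) (?D (snd c q) v) =
          norm v * (norm v * h c' (snd c' (f q)) (?D (snd c q) u) (?D (snd c q) u))"
        by (subst (1 2) v) (simp only: linear_cmul[OF lin] bilinear_lmul[OF bh] bilinear_rmul[OF bh] real_scaleR_def)
      moreover have "g c (snd c q) v v = norm v * (norm v * g c (snd c q) u u)"
        by (subst (1 2) v) (simp only: bilinear_lmul[OF bg] bilinear_rmul[OF bg] real_scaleR_def)
      ultimately show ?thesis
        by (simp add: algebra_simps)
    qed
  qed
  ultimately have "dilation_bounded W K"
    unfolding dilation_bounded_def using c(1) c'(1) by blast
  then show ?thesis
    using \<open>openin X W\<close> \<open>p \<in> W\<close> K(1) less_imp_le by blast
qed

lemma dilation_bounded_compact: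
  assumes "compact_space X"
  shows "\<exists>K\<ge>1. \<forall>q\<in>topspace X. dilation_bounded {q} K"
proof -
  obtain W K where WK: "\<And>p. p \<in> topspace X \<Longrightarrow>
      openin X (W p) \<and> p \<in> W p \<and> 0 \<le> K p \<and> dilation_bounded (W p) (K p)"
    using dilation_locally_bounded by metis
  have "\<exists>\<F>. finite \<F> \<and> \<F> \<subseteq> W ` topspace X \<and> topspace X \<subseteq> \<Union>\<F>"
    using assms WK unfolding compact_space_def by (intro compactinD) auto
  then obtain S where S: "finite S" "S \<subseteq> topspace X" "topspace X \<subseteq> (\<Union>p\<in>S. W p)"
    by (metis finite_subset_image)
  have nonneg: "K p \<ge> 0" if "p \<in> S" for p
    using WK S that by blast
  \<comment> \<open>The sum dominates each local constant because all are non-negative; the extra 1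
    makes the result at least 1, even for empty S.\<close>
  have "dilation_bounded {q} (1 + sum K S)" if q: "q \<in> topspace X" for q
  proof -
    obtain p where p: "p \<in> S" "q \<in> W p"
      using S(3) q by blast
    have "K p \<le> sum K S"
      using member_le_sum[of p S K] S(1) p(1) nonneg by simp
    then have "K p \<le> 1 + sum K S"
      by simp
    then show ?thesis
      using dilation_bounded_mono[of "W p" "K p" "{q}"] WK p S(2) by blast
  qed
  moreover have "1 \<le> 1 + sum K S"
    using nonneg by (simp add: sum_nonneg)
  ultimately show ?thesis
    by blast
qed

text \<open>The estimate is pointwise in time, so the charts may be chosen afresh at each time and
  the curve is subdivided only at its break points.\<close>

lemma curve_length_image_le:
  assumes "compact_space X"
  shows "\<exists>K\<ge>1. \<forall>\<gamma>. piecewise_C1_curve X A \<gamma> \<longrightarrow> curve_length B h (f \<circ> \<gamma>) \<le> K * curve_length A g \<gamma>"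
proof -
  obtain K where K: "K \<ge> 1" "\<forall>q\<in>topspace X. dilation_bounded {q} K"
    using dilation_bounded_compact[OF assms] by blast
  have "curve_length B h (f \<circ> \<gamma>) \<le> sqrt K * curve_length A g \<gamma>" if \<gamma>: "piecewise_C1_curve X A \<gamma>" for \<gamma>
  proof -
    obtain n :: nat and s where s: "s 0 = 0" "s n = 1"
    and pieces: "\<forall>i<n. s i < s (Suc i) \<and> 0 \<le> s i \<and> s (Suc i) \<le> 1 \<and>
      C1_curve_on X A (s i) (s (Suc i)) \<gamma>"
    using piecewise_C1_curve_pieces[OF \<gamma>] by blast
    have "integral {s 0..s n} (speed B h (f \<circ> \<gamma>)) \<le> integral {s 0..s n} (\<lambda>t. sqrt K * speed A g \<gamma> t)"
    proof (rule piecewise_integral_le)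
      fix i assume i: "i < n"
      have ab: "s i < s (Suc i)" "0 \<le> s i" "s (Suc i) \<le> 1"
        and \<gamma>i: "C1_curve_on X A (s i) (s (Suc i)) \<gamma>"
        using pieces i by blast+
      show "speed B h (f \<circ> \<gamma>) integrable_on {s i..s (Suc i)}"
        by (rule speed_integrable_on[OF Y h C1_curve_on_image[OF \<gamma>i ab(1)] ab])
      show "(\<lambda>t. sqrt K * speed A g \<gamma> t) integrable_on {s i..s (Suc i)}"
        using speed_integrable_on[OF X g \<gamma>i ab] by (rule integrable_on_mult_right)
      fix t assume t: "t \<in> {s i<..<s (Suc i)}"
      then have "\<gamma> t \<in> topspace X"
        using C1_curve_on_in_topspace[OF \<gamma>i] by simp
      then obtain c c' where c: "c \<in> A" "\<gamma> t \<in> fst c" "c' \<in> B" "f (\<gamma> t) \<in> fst c'"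
        "dilation_le c c' (\<gamma> t) K"
        using K(2) unfolding dilation_bounded_def by blast
      then show "speed B h (f \<circ> \<gamma>) t \<le> sqrt K * speed A g \<gamma> t"
        by (rule speed_image_le[OF \<gamma>i ab(2,3) t])
    qed (use pieces in blast)
    then show ?thesis
      using s by (simp add: curve_length_def)
  qed
  then show ?thesis
    using K(1) by (intro exI[of _ "sqrt K"]) auto
qed

end

section \<open>Comparison of distances and exponents\<close>

text \<open>This separates the pairs whose distance is a genuine infimum from those whose distance
  is \<open>Inf {}\<close>.\<close>

definition joined_by_curve :: "'a topology \<Rightarrow> ('a, 'e::euclidean_space) chart set \<Rightarrow> 'a \<Rightarrow> 'a \<Rightarrow> bool" where
  "joined_by_curve X A p q \<longleftrightarrow> (\<exists>\<gamma>. piecewise_C1_curve X A \<gamma> \<and> \<gamma> 0 = p \<and> \<gamma> 1 = q)"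

lemma riemannian_dist_not_joined:
  assumes "\<not> joined_by_curve X A p q"
  shows "riemannian_dist X A g p q = Inf {}"
proof -
  have "{curve_length A g \<gamma> |\<gamma>. piecewise_C1_curve X A \<gamma> \<and> \<gamma> 0 = p \<and> \<gamma> 1 = q} = {}"
    using assms unfolding joined_by_curve_def by blast
  then show ?thesis
    by (simp only: riemannian_dist_def)
qed

lemma (in riemannian_map) joined_by_curve_image:
  assumes "joined_by_curve X A p q"
  shows "joined_by_curve Y B (f p) (f q)"
proof -
  obtain \<gamma> where \<gamma>: "piecewise_C1_curve X A \<gamma>" "\<gamma> 0 = p" "\<gamma> 1 = q"
    using assms unfolding joined_by_curve_def by blast
  show ?thesis
    unfolding joined_by_curve_def
    by (rule exI[of _ "f \<circ> \<gamma>"]) (simp add: \<gamma> piecewise_C1_curve_image)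
qed

lemma riemannian_dist_nonneg:
  assumes "smooth_manifold X A" "riemannian_metric A g" "joined_by_curve X A p q"
  shows "riemannian_dist X A g p q \<ge> 0"
  unfolding riemannian_dist_def
  by (rule cInf_greatest)
    (use assms curve_length_nonneg[OF assms(1,2)] in \<open>auto simp: joined_by_curve_def\<close>)

text \<open>The image of any curve from p to q competes for the distance of the image points.
  Dividing by K turns this into a lower bound for all lengths of curves from p to q, to which the
  infimum can be applied.\<close>

lemma (in riemannian_map) riemannian_dist_image_le:
  assumes "compact_space X"
  shows "\<exists>K\<ge>1. \<forall>p q. joined_by_curve X A p q \<longrightarrow>
    riemannian_dist Y B h (f p) (f q) \<le> K * riemannian_dist X A g p q"
proof -
  obtain K where K: "K \<ge> 1" "\<forall>\<gamma>. piecewise_C1_curve X A \<gamma> \<longrightarrow>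
      curve_length B h (f \<circ> \<gamma>) \<le> K * curve_length A g \<gamma>"
    using curve_length_image_le[OF assms] by blast
  have "riemannian_dist Y B h (f p) (f q) \<le> K * riemannian_dist X A g p q"
    if pq: "joined_by_curve X A p q" for p q
  proof -
    have le: "riemannian_dist Y B h (f p) (f q) / K \<le> curve_length A g \<gamma>"
      if \<gamma>: "piecewise_C1_curve X A \<gamma>" "\<gamma> 0 = p" "\<gamma> 1 = q" for \<gamma>
    proof -
      let ?L = "{curve_length B h \<gamma> |\<gamma>. piecewise_C1_curve Y B \<gamma> \<and> \<gamma> 0 = f p \<and> \<gamma> 1 = f q}"
      have "curve_length B h (f \<circ> \<gamma>) \<in> ?L"
        using \<gamma> piecewise_C1_curve_image[OF \<gamma>(1)] by auto
      moreover have "bdd_below ?L"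
        using curve_length_nonneg[OF Y h] by (auto intro!: bdd_belowI[of _ 0])
      ultimately have "riemannian_dist Y B h (f p) (f q) \<le> curve_length B h (f \<circ> \<gamma>)"
        unfolding riemannian_dist_def by (rule cInf_lower)
      also have "\<dots> \<le> K * curve_length A g \<gamma>"
        using K(2) \<gamma>(1) by blast
      finally show ?thesis
        using K(1) by (simp add: field_simps)
    qed
    have "riemannian_dist Y B h (f p) (f q) / K \<le> riemannian_dist X A g p q"
      unfolding riemannian_dist_def[of X]
      by (rule cInf_greatest) (use pq le in \<open>auto simp: joined_by_curve_def\<close>)
    then show ?thesis
      using K(1) by (simp add: field_simps)
  qed
  then show ?thesis
    using K(1) by blast
qed

text \<open>With the signs included, either both numbers are zero or both are positive, which are
  the cases in which their logarithms can be compared.\<close>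

definition comparable :: "real \<Rightarrow> real \<Rightarrow> real \<Rightarrow> bool" where
  "comparable K a b \<longleftrightarrow> 0 \<le> a \<and> 0 \<le> b \<and> a \<le> K * b \<and> b \<le> K * a"

text \<open>\<open>Inf {}\<close> is an unspecified real, possibly negative, and it is the junk value of the
  Riemannian distance of two points that no curve joins. The alternatives below account for it:
  if it is negative and attained, both infima are equal to it.\<close>

lemma comparable_Inf:
  assumes K: "K \<ge> 1"
    and FG: "\<And>m. m \<in> M \<Longrightarrow> comparable K (F m) (G m) \<or> F m = Inf {} \<and> G m = Inf {}"
  shows "comparable K (Inf (F ` M)) (Inf (G ` M)) \<or> Inf (F ` M) = Inf (G ` M)"
proof -
  \<comment> \<open>A pair that is not comparable consists of two copies of \<open>Inf {}\<close>,
    and this number is then negative, since for \<open>K \<ge> 1\<close> a non-negative number is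
    comparable with itself. All other values are non-negative or equal to it, so it is the minimum
    of both families.\<close>
  consider "M = {}" | m where "m \<in> M" "F m = Inf {}" "G m = Inf {}" "Inf {} < (0::real)"
    | "M \<noteq> {}" "\<And>m. m \<in> M \<Longrightarrow> comparable K (F m) (G m)"
  proof (cases "\<exists>m\<in>M. \<not> comparable K (F m) (G m)")
    case True
    then obtain m where m: "m \<in> M" "\<not> comparable K (F m) (G m)" "F m = Inf {}" "G m = Inf {}"
      using FG by blast
    have "Inf {} < (0::real)"
    proof (rule ccontr)
      assume "\<not> Inf {} < (0::real)"
      then have "comparable K (F m) (G m)"
        using m(3,4) K mult_right_mono[of 1 K "Inf {}"] by (simp add: comparable_def)
      then show False using m(2) by blast
    qed
    then show ?thesis using m that(2) by blast
  qed (use that in blast)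
  then show ?thesis
  proof cases
    case 2
    have "Inf (F ` M) = Inf {}" "Inf (G ` M) = Inf {}"
      by (rule cInf_eq_minimum; use 2 FG in \<open>force simp: comparable_def\<close>)+
    then show ?thesis by simp
  next
    case 3
    have le: "0 \<le> Inf (F ` M) \<and> Inf (F ` M) \<le> K * Inf (G ` M)"
      if comp: "\<And>m. m \<in> M \<Longrightarrow> comparable K (F m) (G m)" for F G :: "'a \<Rightarrow> real"
    proof
      show "0 \<le> Inf (F ` M)"
        by (rule cInf_greatest) (use 3(1) comp in \<open>auto simp: comparable_def\<close>)
      have "Inf (F ` M) / K \<le> Inf (G ` M)"
      proof (rule cInf_greatest)
        fix y assume "y \<in> G ` M"
        then obtain m where m: "m \<in> M" "y = G m" by blast
        have "Inf (F ` M) \<le> F m"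
          by (rule cInf_lower) (use m comp in \<open>auto simp: comparable_def intro!: bdd_belowI[of _ 0]\<close>)
        also have "\<dots> \<le> K * y"
          using comp[OF m(1)] m(2) by (simp add: comparable_def)
        finally show "Inf (F ` M) / K \<le> y"
          using K by (simp add: field_simps)
      qed (use 3(1) in simp)
      then show "Inf (F ` M) \<le> K * Inf (G ` M)"
        using K by (simp add: field_simps)
    qed
    have "comparable K (G m) (F m)" if "m \<in> M" for m
      using 3(2)[OF that] by (simp add: comparable_def)
    then show ?thesis
      using le[of F G] le[of G F] 3(2) by (simp add: comparable_def)
  qed simp
qed

text \<open>Writing the discrepancy as a finite additive error covers logarithm -infinity too:
  comparable numbers vanish together, and then \<open>e = 0\<close> works. The alternative
  \<open>a = b\<close> carries the value \<open>Inf {}\<close>, whose sign is unknown.\<close>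

lemma comparable_log_dist:
  assumes "comparable K a b \<or> a = b" "K \<ge> 1"
  shows "\<exists>e. \<bar>e\<bar> \<le> ln K \<and> log_dist b = log_dist a + ereal e"
proof (cases "a = b \<or> a = 0 \<or> b = 0")
  case True
  then have "a = b"
    using assms by (auto simp: comparable_def)
  then show ?thesis
    using assms(2) by (intro exI[of _ 0]) simp
next
  case False
  then have pos: "a > 0" "b > 0" "a \<le> K * b" "b \<le> K * a"
    using assms by (auto simp: comparable_def)
  have "ln a \<le> ln K + ln b" "ln b \<le> ln K + ln a"
    using pos assms(2) by (simp_all flip: ln_mult_pos)
  then show ?thesis
    using pos by (intro exI[of _ "ln b - ln a"]) (auto simp: log_dist_def)
qed

text \<open>After division by t the error lies between \<open>- ln K / t\<close> and
  \<open>ln K / t\<close>. The filter restricts \<open>at_top\<close> to T, so real and integer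
  times are treated alike.\<close>

lemma tendsto_exponent:
  fixes T :: "real set" and a b :: "real \<Rightarrow> real"
  assumes K: "K \<ge> 1" and ab: "\<And>t. t \<in> T \<Longrightarrow> comparable K (a t) (b t) \<or> a t = b t"
    and lim: "((\<lambda>t. ereal (1 / t) * log_dist (a t)) \<longlongrightarrow> l) (inf at_top (principal T))"
  shows "((\<lambda>t. ereal (1 / t) * log_dist (b t)) \<longlongrightarrow> l) (inf at_top (principal T))"
proof -
  let ?F = "inf at_top (principal T)"
  obtain e where e: "\<And>t. t \<in> T \<Longrightarrow> \<bar>e t\<bar> \<le> ln K \<and> log_dist (b t) = log_dist (a t) + ereal (e t)"
    using comparable_log_dist[OF ab K] by metis
  have ev: "eventually (\<lambda>t. t \<in> T \<and> t > 0) ?F"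
    unfolding eventually_inf_principal
    using eventually_gt_at_top[of "0::real"] by (rule eventually_mono) simp
  have "((\<lambda>t::real. ln K / t) \<longlongrightarrow> 0) at_top"
    by (intro tendsto_divide_0[OF tendsto_const] filterlim_at_top_imp_at_infinity filterlim_ident)
  then have "((\<lambda>t. ln K / t) \<longlongrightarrow> 0) ?F"
    by (rule tendsto_mono[rotated]) simp
  then have "((\<lambda>t. e t / t) \<longlongrightarrow> 0) ?F"
    by (rule Lim_null_comparison[rotated], intro eventually_mono[OF ev])
      (use e in \<open>auto simp: divide_right_mono\<close>)
  then have "((\<lambda>t. ereal (e t / t)) \<longlongrightarrow> ereal 0) ?F"
    by (rule tendsto_ereal)
  \<comment> \<open>Here l may be infinite; the sum of limits is still legitimate because the second
    limit is finite.\<close>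
  then have "((\<lambda>t. ereal (1 / t) * log_dist (a t) + ereal (e t / t)) \<longlongrightarrow> l + ereal 0) ?F"
    by (intro tendsto_add_ereal_general lim) auto
  then have "((\<lambda>t. ereal (1 / t) * log_dist (a t) + ereal (e t / t)) \<longlongrightarrow> l) ?F"
    by simp
  moreover have "eventually (\<lambda>t. ereal (1 / t) * log_dist (a t) + ereal (e t / t) =
      ereal (1 / t) * log_dist (b t)) ?F"
    using ev
  proof (rule eventually_mono)
    fix t assume "t \<in> T \<and> t > 0"
    \<comment> \<open>The case split covers \<open>log_dist (a t) = -\<infinity>\<close>, where both
      sides are \<open>-\<infinity>\<close> because \<open>t > 0\<close>.\<close>
    then show "ereal (1 / t) * log_dist (a t) + ereal (e t / t) = ereal (1 / t) * log_dist (b t)"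
      using e[of t] by (cases "log_dist (a t)") (auto simp: field_simps)
  qed
  ultimately show ?thesis
    by (rule Lim_transform_eventually)
qed

text \<open>No manifold appears here: distances enter only through their comparison and stable sets
  only through the topology. The lemma therefore serves both for \<open>\<psi>\<close> and for
  \<open>id\<close> with two metrics.\<close>

lemma metric_exponents_conjugate:
  assumes \<psi>: "homeomorphic_map X Y \<psi>" and \<Phi>: "flow T X \<Phi>" and M: "M \<subseteq> topspace X"
    and conj: "\<And>t x. t \<in> T \<Longrightarrow> x \<in> topspace X \<Longrightarrow> \<Psi> t (\<psi> x) = \<psi> (\<Phi> t x)"
    and K: "K \<ge> 1"
    and dist: "\<And>p q. p \<in> topspace X \<Longrightarrow> q \<in> topspace X \<Longrightarrow>
      comparable K (d p q) (d' (\<psi> p) (\<psi> q)) \<or> d p q = Inf {} \<and> d' (\<psi> p) (\<psi> q) = Inf {}"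
  shows metric_regular_conjugate:
      "\<And>x. x \<in> topspace X \<Longrightarrow> metric_regular T Y d' \<Psi> (\<psi> ` M) (\<psi> x) \<longleftrightarrow> metric_regular T X d \<Phi> M x"
    and metric_exponent_conjugate:
      "\<And>x. x \<in> topspace X \<Longrightarrow> metric_exponent T d' \<Psi> (\<psi> ` M) (\<psi> x) = metric_exponent T d \<Phi> M x"
    and metric_spectrum_conjugate:
      "metric_spectrum T Y d' \<Psi> (\<psi> ` M) = metric_spectrum T X d \<Phi> M"
proof -
  have T: "0 \<in> T" and maps: "\<And>t x. t \<in> T \<Longrightarrow> x \<in> topspace X \<Longrightarrow> \<Phi> t x \<in> topspace X"
    using \<Phi> unfolding flow_def continuous_map_def by (auto simp: Pi_iff)
  have inj: "inj_on \<psi> (topspace X)" and surj: "\<psi> ` topspace X = topspace Y"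
    using \<psi> by (auto simp: homeomorphic_map_def quotient_map_def)
  \<comment> \<open>Equality of predicates in the limit l transfers at once the existence of a limit
    and the value picked by \<open>THE\<close>, without appeal to uniqueness of limits.\<close>
  have exponent: "has_metric_exponent T d' \<Psi> (\<psi> ` M) (\<psi> x) = has_metric_exponent T d \<Phi> M x"
    if x: "x \<in> topspace X" for x
  proof
    fix l
    have comp: "comparable K (point_set_dist d (\<Phi> t x) M) (point_set_dist d' (\<Psi> t (\<psi> x)) (\<psi> ` M)) \<or>
        point_set_dist d (\<Phi> t x) M = point_set_dist d' (\<Psi> t (\<psi> x)) (\<psi> ` M)" if t: "t \<in> T" for t
      using comparable_Inf[OF K, of M "d (\<Phi> t x)" "\<lambda>m. d' (\<psi> (\<Phi> t x)) (\<psi> m)"]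
        dist[OF maps[OF t x]] M conj[OF t x]
      unfolding point_set_dist_def image_image by (simp add: subset_iff)
    have comp': "comparable K (point_set_dist d' (\<Psi> t (\<psi> x)) (\<psi> ` M)) (point_set_dist d (\<Phi> t x) M) \<or>
        point_set_dist d' (\<Psi> t (\<psi> x)) (\<psi> ` M) = point_set_dist d (\<Phi> t x) M" if t: "t \<in> T" for t
      using comp[OF t] by (auto simp: comparable_def)
    show "has_metric_exponent T d' \<Psi> (\<psi> ` M) (\<psi> x) l \<longleftrightarrow> has_metric_exponent T d \<Phi> M x l"
      unfolding has_metric_exponent_def
    proof
      assume "((\<lambda>t. ereal (1 / t) * log_dist (point_set_dist d' (\<Psi> t (\<psi> x)) (\<psi> ` M))) \<longlongrightarrow> l)
        (inf at_top (principal T))"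
      then show "((\<lambda>t. ereal (1 / t) * log_dist (point_set_dist d (\<Phi> t x) M)) \<longlongrightarrow> l)
        (inf at_top (principal T))"
        by (rule tendsto_exponent[OF K, rotated]) (rule comp')
    next
      assume "((\<lambda>t. ereal (1 / t) * log_dist (point_set_dist d (\<Phi> t x) M)) \<longlongrightarrow> l)
        (inf at_top (principal T))"
      then show "((\<lambda>t. ereal (1 / t) * log_dist (point_set_dist d' (\<Psi> t (\<psi> x)) (\<psi> ` M))) \<longlongrightarrow> l)
        (inf at_top (principal T))"
        by (rule tendsto_exponent[OF K, rotated]) (rule comp)
    qed
  qed
  have stable: "\<psi> x \<in> stable_set T Y \<Psi> (\<psi> ` M) \<longleftrightarrow> x \<in> stable_set T X \<Phi> M"
    if x: "x \<in> topspace X" for x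
  proof -
    have "Y closure_of {\<Psi> t (\<psi> x) |t. t \<in> T \<and> s \<le> t} =
        \<psi> ` (X closure_of {\<Phi> t x |t. t \<in> T \<and> s \<le> t})" for s
    proof -
      have "{\<Psi> t (\<psi> x) |t. t \<in> T \<and> s \<le> t} = \<psi> ` {\<Phi> t x |t. t \<in> T \<and> s \<le> t}"
        unfolding setcompr_eq_image image_image by (rule image_cong) (use conj[OF _ x] in auto)
      moreover have "{\<Phi> t x |t. t \<in> T \<and> s \<le> t} \<subseteq> topspace X"
        using maps[OF _ x] by blast
      ultimately show ?thesis
        using homeomorphic_map_closure_of[OF \<psi>] by simp
    qed
    \<comment> \<open>Injectivity lets the image commute with the intersection over T;
      \<open>0 \<in> T\<close> makes this intersection non-empty as a family.\<close>
    then have "omega_limit T Y \<Psi> (\<psi> x) = \<psi> ` omega_limit T X \<Phi> x"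
      unfolding omega_limit_def
      using image_INT[OF inj, of T "\<lambda>s. X closure_of {\<Phi> t x |t. t \<in> T \<and> s \<le> t}"] T
      by (simp add: closure_of_subset_topspace)
    moreover have "omega_limit T X \<Phi> x \<subseteq> topspace X"
      unfolding omega_limit_def using T closure_of_subset_topspace by fast
    ultimately show ?thesis
      unfolding stable_set_def using x surj inj_on_image_subset_iff[OF inj _ M] by auto
  qed
  show regular: "metric_regular T Y d' \<Psi> (\<psi> ` M) (\<psi> x) \<longleftrightarrow> metric_regular T X d \<Phi> M x"
    if "x \<in> topspace X" for x
    unfolding metric_regular_def using exponent[OF that] stable[OF that] by simp
  show exp: "metric_exponent T d' \<Psi> (\<psi> ` M) (\<psi> x) = metric_exponent T d \<Phi> M x"
    if "x \<in> topspace X" for x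
    unfolding metric_exponent_def using exponent[OF that] by simp
  have regular_image: "{y. metric_regular T Y d' \<Psi> (\<psi> ` M) y} = \<psi> ` {x. metric_regular T X d \<Phi> M x}"
  proof (intro equalityI subsetI)
    fix y assume y: "y \<in> {y. metric_regular T Y d' \<Psi> (\<psi> ` M) y}"
    then have "y \<in> \<psi> ` topspace X"
      unfolding surj by (simp add: metric_regular_def stable_set_def)
    then show "y \<in> \<psi> ` {x. metric_regular T X d \<Phi> M x}"
      using y regular by auto
  next
    fix y assume "y \<in> \<psi> ` {x. metric_regular T X d \<Phi> M x}"
    then obtain x where x: "y = \<psi> x" "metric_regular T X d \<Phi> M x"
      by auto
    then have "x \<in> topspace X"
      by (simp add: metric_regular_def stable_set_def)
    then show "y \<in> {y. metric_regular T Y d' \<Psi> (\<psi> ` M) y}"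
      using x regular by simp
  qed
  show "metric_spectrum T Y d' \<Psi> (\<psi> ` M) = metric_spectrum T X d \<Phi> M"
    unfolding metric_spectrum_def setcompr_eq_image regular_image image_image
  proof (rule image_cong[OF refl])
    fix x assume "x \<in> {x. metric_regular T X d \<Phi> M x}"
    then have "x \<in> topspace X"
      by (simp add: metric_regular_def stable_set_def)
    then show "metric_exponent T d' \<Psi> (\<psi> ` M) (\<psi> x) = metric_exponent T d \<Phi> M x"
      by (rule exp)
  qed
qed

text \<open>One inequality comes from f, the other from f' at the points \<open>f p\<close> and
  \<open>f q\<close>, which f' sends back to p and q. If no curve joins p and q, none joins their
  images either, since f' would carry it back.\<close>

lemma riemannian_dist_comparable:
  assumes f: "riemannian_map X A Y B f g h" and f': "riemannian_map Y B X A f' h g"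
    and compact: "compact_space X" "compact_space Y"
    and inv: "\<And>p. p \<in> topspace X \<Longrightarrow> f' (f p) = p"
  shows "\<exists>K\<ge>1. \<forall>p\<in>topspace X. \<forall>q\<in>topspace X.
    comparable K (riemannian_dist X A g p q) (riemannian_dist Y B h (f p) (f q)) \<or>
    riemannian_dist X A g p q = Inf {} \<and> riemannian_dist Y B h (f p) (f q) = Inf {}"
proof -
  interpret f: riemannian_map X A Y B f g h by (rule f)
  interpret f': riemannian_map Y B X A f' h g by (rule f')
  obtain K where K: "K \<ge> 1" "\<And>p q. joined_by_curve X A p q \<Longrightarrow>
      riemannian_dist Y B h (f p) (f q) \<le> K * riemannian_dist X A g p q"
    using f.riemannian_dist_image_le[OF compact(1)] by blast
  obtain K' where K': "K' \<ge> 1" "\<And>p q. joined_by_curve Y B p q \<Longrightarrow>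
      riemannian_dist X A g (f' p) (f' q) \<le> K' * riemannian_dist Y B h p q"
    using f'.riemannian_dist_image_le[OF compact(2)] by blast
  show ?thesis
  proof (intro exI[of _ "max K K'"] conjI ballI)
    show "1 \<le> max K K'" using K by simp
    fix p q assume p: "p \<in> topspace X" and q: "q \<in> topspace X"
    show "comparable (max K K') (riemannian_dist X A g p q) (riemannian_dist Y B h (f p) (f q)) \<or>
      riemannian_dist X A g p q = Inf {} \<and> riemannian_dist Y B h (f p) (f q) = Inf {}"
    proof (cases "joined_by_curve X A p q")
      case True
      then have True': "joined_by_curve Y B (f p) (f q)"
        by (rule f.joined_by_curve_image)
      have nonneg: "0 \<le> riemannian_dist X A g p q" "0 \<le> riemannian_dist Y B h (f p) (f q)"
        using riemannian_dist_nonneg[OF f.X f.g True] riemannian_dist_nonneg[OF f.Y f.h True'] .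
      have "riemannian_dist Y B h (f p) (f q) \<le> max K K' * riemannian_dist X A g p q"
        using K(2)[OF True] mult_right_mono[OF max.cobounded1 nonneg(1), of K K'] by linarith
      moreover have "riemannian_dist X A g p q \<le> max K K' * riemannian_dist Y B h (f p) (f q)"
        using K'(2)[OF True'] mult_right_mono[OF max.cobounded2 nonneg(2), of K' K] inv p q by simp
      ultimately show ?thesis
        using nonneg by (simp add: comparable_def)
    next
      case False
      then have "\<not> joined_by_curve Y B (f p) (f q)"
        using f'.joined_by_curve_image inv p q by metis
      then show ?thesis
        using False riemannian_dist_not_joined by metis
    qed
  qed
qed

theorem corollary3p2:
  fixes X :: "'a topology" and A :: "('a, 'e::euclidean_space) chart set"
    and g :: "('a, 'e) metric_field"
    and Y :: "'b topology" and B :: "('b, 'f::euclidean_space) chart set"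
    and h :: "('b, 'f) metric_field"
    and T :: "real set" and \<Phi> :: "real \<Rightarrow> 'a \<Rightarrow> 'a" and \<Psi> :: "real \<Rightarrow> 'b \<Rightarrow> 'b"
    and M :: "'a set" and \<psi> :: "'a \<Rightarrow> 'b"
  assumes "riemannian_manifold X A g" and "compact_space X"
    and "riemannian_manifold Y B h"
    and "flow T X \<Phi>"
    and "compactin X M" and "invariant_set T \<Phi> M" and "isolated_set T X \<Phi> M"
    and not_repeller: "stable_set T X \<Phi> M \<noteq> {}"
    and "diffeomorphism X A Y B \<psi>"
    and conjugate: "\<forall>t\<in>T. \<forall>y\<in>topspace Y. \<Psi> t y = \<psi> (\<Phi> t (inv_into (topspace X) \<psi> y))"
  shows "(\<forall>x. metric_regular T X (riemannian_dist X A g) \<Phi> M x \<longrightarrow>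
            metric_regular T Y (riemannian_dist Y B h) \<Psi> (\<psi> ` M) (\<psi> x) \<and>
            metric_exponent T (riemannian_dist X A g) \<Phi> M x =
              metric_exponent T (riemannian_dist Y B h) \<Psi> (\<psi> ` M) (\<psi> x)) \<and>
         metric_spectrum T X (riemannian_dist X A g) \<Phi> M =
           metric_spectrum T Y (riemannian_dist Y B h) \<Psi> (\<psi> ` M) \<and>
         (\<forall>g'. riemannian_metric A g' \<longrightarrow>
            metric_spectrum T X (riemannian_dist X A g) \<Phi> M =
              metric_spectrum T X (riemannian_dist X A g') \<Phi> M)"
proof -
  let ?\<psi>' = "inv_into (topspace X) \<psi>"
  have X: "smooth_manifold X A" "riemannian_metric A g" and Y: "smooth_manifold Y B" "riemannian_metric B h"
    using assms(1,3) by (auto simp: riemannian_manifold_def)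
  have M: "M \<subseteq> topspace X"
    using \<open>compactin X M\<close> by (rule compactin_subset_topspace)
  have bij: "bij_betw \<psi> (topspace X) (topspace Y)" and smooth: "smooth_map X A Y B \<psi>" "smooth_map Y B X A ?\<psi>'"
    using \<open>diffeomorphism X A Y B \<psi>\<close> by (auto simp: diffeomorphism_def)
  have inv: "?\<psi>' (\<psi> p) = p" if "p \<in> topspace X" for p
    using bij that by (simp add: bij_betw_def)
  have "homeomorphic_maps X Y \<psi> ?\<psi>'"
    using smooth inv bij by (auto simp: homeomorphic_maps_def smooth_map_def bij_betw_inv_into_right)
  then have homeo: "homeomorphic_map X Y \<psi>"
    using homeomorphic_map_maps by blast
  \<comment> \<open>The dilation bound for the inverse map is obtained by compactness of its own
    source.\<close>
  have "compact_space Y"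
    using \<open>compact_space X\<close> homeo homeomorphic_compact_space homeomorphic_map_imp_homeomorphic_space by blast
  have maps: "riemannian_map X A Y B \<psi> g h" "riemannian_map Y B X A ?\<psi>' h g"
    using X Y smooth
    by (simp_all add: riemannian_map_def manifold_map_def riemannian_map_axioms_def)
  obtain K where K: "K \<ge> 1"
    "\<forall>p\<in>topspace X. \<forall>q\<in>topspace X.
      comparable K (riemannian_dist X A g p q) (riemannian_dist Y B h (\<psi> p) (\<psi> q)) \<or>
      riemannian_dist X A g p q = Inf {} \<and> riemannian_dist Y B h (\<psi> p) (\<psi> q) = Inf {}"
    using riemannian_dist_comparable[OF maps \<open>compact_space X\<close> \<open>compact_space Y\<close> inv] by blast
  have conj: "\<Psi> t (\<psi> x) = \<psi> (\<Phi> t x)" if "t \<in> T" "x \<in> topspace X" for t x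
    using conjugate that inv[OF that(2)] bij_betwE[OF bij] by simp
  note spectrum = metric_exponents_conjugate[where d = "riemannian_dist X A g" and
      d' = "riemannian_dist Y B h" and \<Psi> = \<Psi>, OF homeo \<open>flow T X \<Phi>\<close> M conj K(1) K(2)[rule_format]]
  have metric: "metric_spectrum T X (riemannian_dist X A g') \<Phi> M =
      metric_spectrum T X (riemannian_dist X A g) \<Phi> M" if g': "riemannian_metric A g'" for g'
  proof -
    have id: "riemannian_map X A X A id g g'" "riemannian_map X A X A id g' g"
      using identity_manifold_map[OF X(1)] X(2) g'
      by (simp_all add: riemannian_map_def riemannian_map_axioms_def)
    obtain L where L: "L \<ge> 1"
      "\<forall>p\<in>topspace X. \<forall>q\<in>topspace X.
        comparable L (riemannian_dist X A g p q) (riemannian_dist X A g' (id p) (id q)) \<or>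
        riemannian_dist X A g p q = Inf {} \<and> riemannian_dist X A g' (id p) (id q) = Inf {}"
      using riemannian_dist_comparable[OF id \<open>compact_space X\<close> \<open>compact_space X\<close>] by auto
    have "homeomorphic_map X X id"
      by (simp add: homeomorphic_map_id)
    then have "metric_spectrum T X (riemannian_dist X A g') \<Phi> (id ` M) =
        metric_spectrum T X (riemannian_dist X A g) \<Phi> M"
      by (rule metric_spectrum_conjugate[where d = "riemannian_dist X A g" and
            d' = "riemannian_dist X A g'", OF _ \<open>flow T X \<Phi>\<close> M _ L(1) L(2)[rule_format]]) auto
    then show ?thesis by simp
  qed
  show ?thesis
  proof (intro conjI allI impI)
    fix x assume x: "metric_regular T X (riemannian_dist X A g) \<Phi> M x"
    then have "x \<in> topspace X"
      by (simp add: metric_regular_def stable_set_def)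
    then show "metric_regular T Y (riemannian_dist Y B h) \<Psi> (\<psi> ` M) (\<psi> x)"
      "metric_exponent T (riemannian_dist X A g) \<Phi> M x =
        metric_exponent T (riemannian_dist Y B h) \<Psi> (\<psi> ` M) (\<psi> x)"
      using x spectrum(1,2) by auto
  qed (use spectrum(3) metric in auto)
qed

end
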